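(* Let $G$ be a connected Lie group and $\mathfrak g$ its Lie algebra. Let $V$ be a vector subspace of $\mathfrak g$ such that the Lie algebra generated by $V$ is $\mathfrak g$. Let $\{v_1,\ldots,v_k\}$ be a basis of $V$ such that $$\left\{\sum_{i=1}^k a_iv_i:\ a_i\in[-2,2],\ i=1,\ldots,k\right\}$$ is contained in a neighborhood $A$ of $0\in\mathfrak g$ such that $\exp|_A$ is a diffeomorphism onto its image. Denote $x_i=\exp(-v_i)$, $y_i=\exp(\sqrt2\,v_i)$ for $i=1,\ldots,k$, and $X=\{e,x_1,\ldots,x_k,y_1,\ldots,y_k\}$. Then $\bar S_X=G$.
   Context: $e$ is the identity of $G$. For a finite subset $X$ of $G$, $S_X$ is the semigroup generated by $X$, i.e. the set of all finite products $z_1\cdots z_m$ with $m\in\mathbb N$ and $z_j\in X$; $\bar S_X$ is its closure in $G$. *)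

theory Defs
  imports "HOL-Analysis.Analysis" "HOL-Library.Function_Algebras"
begin

text \<open>Vector fields are encoded below as functions, and this instance makes the library's
  \<open>subspace\<close>, \<open>span\<close>, \<open>independent\<close> and \<open>linear\<close> available for them.\<close>

instantiation "fun" :: (type, real_vector) real_vector
begin

definition scaleR_fun :: "real \<Rightarrow> ('a \<Rightarrow> 'b) \<Rightarrow> 'a \<Rightarrow> 'b"
  where "scaleR_fun r f = (\<lambda>x. r *\<^sub>R f x)"

instance
  by standard (simp_all add: scaleR_fun_def fun_eq_iff scaleR_add_right scaleR_add_left)

end

section \<open>Smooth maps and smooth manifolds\<close>

text \<open>Only used for open \<open>S\<close> in finite-dimensional spaces, where asking for all iterated directional
  derivatives of the total derivative gives the usual classes \<open>C\<^sup>n\<close>.\<close>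

primrec C_n_on :: "nat \<Rightarrow> 'a set \<Rightarrow> ('a::real_normed_vector \<Rightarrow> 'b::real_normed_vector) \<Rightarrow> bool" where
  "C_n_on 0 S f \<longleftrightarrow> continuous_on S f"
| "C_n_on (Suc n) S f \<longleftrightarrow>
     (\<forall>x\<in>S. f differentiable (at x)) \<and>
     (\<forall>v. C_n_on n S (\<lambda>x. frechet_derivative f (at x) v))"

definition smooth_on :: "'a set \<Rightarrow> ('a::real_normed_vector \<Rightarrow> 'b::real_normed_vector) \<Rightarrow> bool"
  where "smooth_on S f \<longleftrightarrow> (\<forall>n. C_n_on n S f)"

text \<open>A chart is a pair of its domain and its coordinate map; the values of the coordinate map
  outside the domain are irrelevant. The model space \<open>'e\<close> is a finite-dimensional normed space
  rather than a \<open>euclidean_space\<close>, so that dimension 0 is not excluded.\<close>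

type_synonym ('g, 'e) chart = "'g set \<times> ('g \<Rightarrow> 'e)"

definition chart_inv :: "('g, 'e) chart \<Rightarrow> 'e \<Rightarrow> 'g"
  where "chart_inv c = inv_into (fst c) (snd c)"

definition smooth_atlas :: "('g::topological_space, 'e::real_normed_vector) chart set \<Rightarrow> bool" where
  "smooth_atlas charts \<longleftrightarrow>
     (\<exists>B::'e set. finite B \<and> span B = UNIV) \<and>
     (\<Union>c\<in>charts. fst c) = UNIV \<and>
     (\<forall>c\<in>charts. open (fst c) \<and> open (snd c ` fst c) \<and>
        homeomorphism (fst c) (snd c ` fst c) (snd c) (chart_inv c)) \<and>
     (\<forall>c\<in>charts. \<forall>d\<in>charts. smooth_on (snd c ` (fst c \<inter> fst d)) (snd d \<circ> chart_inv c))"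

definition product_atlas ::
    "('g, 'e) chart set \<Rightarrow> ('h, 'f) chart set \<Rightarrow> ('g \<times> 'h, 'e \<times> 'f) chart set" where
  "product_atlas \<A> \<B> = {(fst c \<times> fst d, map_prod (snd c) (snd d)) | c d. c \<in> \<A> \<and> d \<in> \<B>}"

definition model_atlas :: "('e, 'e) chart set"
  where "model_atlas = {(UNIV, id)}"

definition smooth_map_on ::
    "'g set \<Rightarrow> ('g::topological_space, 'e::real_normed_vector) chart set \<Rightarrow>
     ('h::topological_space, 'f::real_normed_vector) chart set \<Rightarrow> ('g \<Rightarrow> 'h) \<Rightarrow> bool" where
  "smooth_map_on S \<A> \<B> f \<longleftrightarrow> open S \<and> continuous_on S f \<and>
     (\<forall>c\<in>\<A>. \<forall>d\<in>\<B>.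
        smooth_on (snd c ` (S \<inter> fst c \<inter> f -` fst d)) (snd d \<circ> f \<circ> chart_inv c))"

definition diffeo_onto_image ::
    "'g set \<Rightarrow> ('g::topological_space, 'e::real_normed_vector) chart set \<Rightarrow>
     ('h::topological_space, 'f::real_normed_vector) chart set \<Rightarrow> ('g \<Rightarrow> 'h) \<Rightarrow> bool" where
  "diffeo_onto_image S \<A> \<B> f \<longleftrightarrow>
     inj_on f S \<and> smooth_map_on S \<A> \<B> f \<and> smooth_map_on (f ` S) \<B> \<A> (inv_into S f)"

section \<open>Lie groups\<close>

locale lie_group = group gmul e ginv
  for gmul :: "'g::{t2_space, second_countable_topology} \<Rightarrow> 'g \<Rightarrow> 'g"
    and e :: 'g and ginv :: "'g \<Rightarrow> 'g" +
  fixes charts :: "('g, 'e::real_normed_vector) chart set"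
  assumes atlas: "smooth_atlas charts"
    and smooth_mult: "smooth_map_on UNIV (product_atlas charts charts) charts (\<lambda>(x, y). gmul x y)"
    and smooth_ginv: "smooth_map_on UNIV charts charts ginv"

section \<open>The Lie algebra of left-invariant vector fields\<close>

text \<open>A vector field is given by its local representatives: \<open>X c p\<close> is the component vector of the
  tangent vector \<open>X\<^sub>p\<close> in the chart \<open>c\<close>. Where this is meaningless (\<open>c\<close> not in the atlas, or
  \<open>p\<close> not in the domain of \<open>c\<close>) the value is required to be \<open>0\<close>, so that equal vector fields are
  equal functions.\<close>

type_synonym ('g, 'e) field = "('g, 'e) chart \<Rightarrow> 'g \<Rightarrow> 'e"

definition smooth_field ::
    "('g, 'e::real_normed_vector) chart set \<Rightarrow> ('g, 'e) field \<Rightarrow> bool" where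
  "smooth_field charts X \<longleftrightarrow>
     (\<forall>c p. \<not> (c \<in> charts \<and> p \<in> fst c) \<longrightarrow> X c p = 0) \<and>
     (\<forall>c\<in>charts. \<forall>d\<in>charts. \<forall>p \<in> fst c \<inter> fst d.
        X d p = frechet_derivative (snd d \<circ> chart_inv c) (at (snd c p)) (X c p)) \<and>
     (\<forall>c\<in>charts. smooth_on (snd c ` fst c) (X c \<circ> chart_inv c))"

definition left_invariant ::
    "('g \<Rightarrow> 'g \<Rightarrow> 'g) \<Rightarrow> ('g, 'e::real_normed_vector) chart set \<Rightarrow> ('g, 'e) field \<Rightarrow> bool" where
  "left_invariant gmul charts X \<longleftrightarrow>
     (\<forall>g. \<forall>c\<in>charts. \<forall>d\<in>charts. \<forall>p \<in> fst c. gmul g p \<in> fst d \<longrightarrow>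
        X d (gmul g p) =
          frechet_derivative (snd d \<circ> gmul g \<circ> chart_inv c) (at (snd c p)) (X c p))"

definition lie_algebra ::
    "('g \<Rightarrow> 'g \<Rightarrow> 'g) \<Rightarrow> ('g, 'e::real_normed_vector) chart set \<Rightarrow> ('g, 'e) field set" where
  "lie_algebra gmul charts = {X. smooth_field charts X \<and> left_invariant gmul charts X}"

text \<open>The commutator of vector fields; in coordinates,
  \<open>[X, Y]\<^sup>i = \<Sum>\<^sub>j X\<^sup>j \<partial>\<^sub>j Y\<^sup>i - Y\<^sup>j \<partial>\<^sub>j X\<^sup>i\<close>.\<close>

definition lie_bracket ::
    "('g, 'e::real_normed_vector) chart set \<Rightarrow> ('g, 'e) field \<Rightarrow> ('g, 'e) field \<Rightarrow> ('g, 'e) field" where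
  "lie_bracket charts X Y = (\<lambda>c p.
     if c \<in> charts \<and> p \<in> fst c then
       frechet_derivative (Y c \<circ> chart_inv c) (at (snd c p)) (X c p)
       - frechet_derivative (X c \<circ> chart_inv c) (at (snd c p)) (Y c p)
     else 0)"

definition lie_subalgebra ::
    "('g \<Rightarrow> 'g \<Rightarrow> 'g) \<Rightarrow> ('g, 'e::real_normed_vector) chart set \<Rightarrow> ('g, 'e) field set \<Rightarrow> bool" where
  "lie_subalgebra gmul charts W \<longleftrightarrow>
     W \<subseteq> lie_algebra gmul charts \<and> subspace W \<and> (\<forall>X\<in>W. \<forall>Y\<in>W. lie_bracket charts X Y \<in> W)"

definition lie_algebra_generated ::
    "('g \<Rightarrow> 'g \<Rightarrow> 'g) \<Rightarrow> ('g, 'e::real_normed_vector) chart set \<Rightarrow>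
     ('g, 'e) field set \<Rightarrow> ('g, 'e) field set" where
  "lie_algebra_generated gmul charts V = \<Inter>{W. lie_subalgebra gmul charts W \<and> V \<subseteq> W}"

section \<open>The exponential map\<close>

definition integral_curve ::
    "('g::topological_space, 'e::real_normed_vector) chart set \<Rightarrow> ('g, 'e) field \<Rightarrow>
     (real \<Rightarrow> 'g) \<Rightarrow> bool" where
  "integral_curve charts X \<gamma> \<longleftrightarrow> continuous_on UNIV \<gamma> \<and>
     (\<forall>t. \<forall>c\<in>charts. \<gamma> t \<in> fst c \<longrightarrow>
        ((snd c \<circ> \<gamma>) has_vector_derivative X c (\<gamma> t)) (at t))"

definition lie_exp ::
    "'g \<Rightarrow> ('g::topological_space, 'e::real_normed_vector) chart set \<Rightarrow> ('g, 'e) field \<Rightarrow> 'g" where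
  "lie_exp e charts X = (THE \<gamma>. integral_curve charts X \<gamma> \<and> \<gamma> 0 = e) 1"

text \<open>The Lie algebra is finite-dimensional, of the same dimension as \<open>'e\<close>. Its topology and smooth
  structure are those transported from \<open>'e\<close> by a linear isomorphism \<open>L\<close>; they do not depend on the
  choice of \<open>L\<close>. In particular \<open>A\<close> is open in the Lie algebra (this is part of
  \<^const>\<open>smooth_map_on\<close>).\<close>

definition exp_diffeo_on ::
    "('g::topological_space \<Rightarrow> 'g \<Rightarrow> 'g) \<Rightarrow> 'g \<Rightarrow> ('g, 'e::real_normed_vector) chart set \<Rightarrow>
     ('g, 'e) field set \<Rightarrow> bool" where
  "exp_diffeo_on gmul e charts A \<longleftrightarrow>
     A \<subseteq> lie_algebra gmul charts \<and>
     (\<exists>L :: 'e \<Rightarrow> ('g, 'e) field. linear L \<and> bij_betw L UNIV (lie_algebra gmul charts) \<and>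
        diffeo_onto_image (L -` A) model_atlas charts (lie_exp e charts \<circ> L))"

section \<open>The semigroup generated by a set\<close>

definition semigroup_generated :: "('g \<Rightarrow> 'g \<Rightarrow> 'g) \<Rightarrow> 'g \<Rightarrow> 'g set \<Rightarrow> 'g set" where
  "semigroup_generated gmul e X = {foldr gmul zs e | zs. zs \<noteq> [] \<and> set zs \<subseteq> X}"

end

theory Submission
  imports Defs
begin

text \<open>
  Since \<open>-1\<close> and \<open>\<surd>2\<close> generate a dense additive semigroup of the reals, the closure \<open>H\<close> of the
  generated semigroup contains the one-parameter subgroups of all \<open>v\<^sub>i\<close>, and hence so does the closed
  subgroup \<open>K = H \<inter> H\<^sup>-\<^sup>1\<close>. The fields \<open>Z\<close> with \<open>exp (t Z) \<in> K\<close> for all \<open>t\<close> form a Lie subalgebra: if a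
  curve \<open>\<kappa>\<close> in \<open>K\<close> starts at \<open>e\<close> with one-sided derivative \<open>Z\<close>, then \<open>\<kappa> (t / n) ^ n\<close> tends to \<open>exp (t Z)\<close>;
  this is applied to \<open>exp (s X) exp (s Y)\<close> for sums and to the group commutator of \<open>exp (\<surd>s X)\<close> and
  \<open>exp (\<surd>s Y)\<close> for brackets. So this subalgebra is everything, \<open>K\<close> contains the open set \<open>exp A\<close>,
  and a clopen subgroup of a connected group is the whole group.

  Two facts usually taken from general theory are read off the hypotheses. Left-invariant fields are
  complete because \<open>exp\<close> is injective near \<open>0\<close>, and they are closed under brackets because otherwise
  no Lie subalgebra would contain \<open>V\<close> and the generated algebra would be an empty
  intersection, that is, the space of all functions.
\<close>

section \<open>Finite-dimensional normed spaces\<close>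

text \<open>Finite-dimensionality in quantitative form: bounded coefficients turn values on
  \<open>B\<close> into bounds for whole linear maps.\<close>

definition coord_basis :: "'e::real_normed_vector set \<Rightarrow> real \<Rightarrow> bool" where
  "coord_basis B C \<longleftrightarrow> finite B \<and> 0 \<le> C \<and>
     (\<forall>w. \<exists>a. w = (\<Sum>b\<in>B. a b *\<^sub>R b) \<and> (\<forall>b\<in>B. \<bar>a b\<bar> \<le> C * norm w))"

text \<open>Equivalence of norms by compactness: scaling the largest coefficient to 1 puts the
  coefficients in a compact box on which the norm of the combination has, by independence, a
  positive minimum.\<close>

lemma coord_basis_exists:
  fixes A :: "'e::real_normed_vector set"
  assumes "finite A" "span A = UNIV"
  obtains B :: "'e set" and C where "coord_basis B C"
proof -
  obtain B where B: "B \<subseteq> A" "independent B" "A \<subseteq> span B"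
    by (rule maximal_independent_subset)
  have fB: "finite B" using B(1) assms(1) finite_subset by blast
  have spB: "span B = UNIV" using assms(2) B(3) by (metis span_mono span_span top.extremum_unique)
  \<comment> \<open>Coefficient functions live on the whole type, with value 0 off \<open>B\<close>,
    so the box is a product of compact sets and Tychonoff applies.\<close>
  define K where "K b0 = PiE UNIV (\<lambda>b. if b = b0 then {1} else if b \<in> B then {-1..1} else {0::real})" for b0
  have "compact (K b0)" for b0
  proof -
    have "euclidean = product_topology (\<lambda>i::'e. euclidean :: real topology) UNIV"
      by (simp add: euclidean_product_topology)
    moreover have "compactin (product_topology (\<lambda>i::'e. euclidean :: real topology) UNIV) (K b0)"
      unfolding K_def compactin_PiE by simp
    ultimately show ?thesis by (metis compactin_euclidean_iff)
  qed
  define f :: "('e \<Rightarrow> real) \<Rightarrow> real" where "f a = norm (\<Sum>b\<in>B. a b *\<^sub>R b)" for a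
  have cf: "continuous_on S f" for S unfolding f_def
    by (intro continuous_intros continuous_on_subset [OF continuous_on_product_coordinates]) auto
  have "\<exists>c>0. \<forall>a\<in>K b0. c \<le> f a" if "b0 \<in> B" for b0
  proof -
    have "(\<lambda>b. if b = b0 then 1 else 0) \<in> K b0" by (auto simp: K_def)
    then obtain m where m: "m \<in> K b0" "\<And>a. a \<in> K b0 \<Longrightarrow> f m \<le> f a"
      using continuous_attains_inf [OF \<open>compact (K b0)\<close> _ cf] by blast
    have "m b0 = 1" using m(1) by (auto simp: K_def PiE_iff split: if_splits)
    then have "f m \<noteq> 0"
      using independentD [OF B(2) fB order_refl, of m b0] that unfolding f_def by auto
    then show ?thesis using m by (intro exI [of _ "f m"]) (auto simp: f_def)
  qed
  then obtain c where c: "\<And>b0. b0 \<in> B \<Longrightarrow> c b0 > 0" "\<And>b0 a. b0 \<in> B \<Longrightarrow> a \<in> K b0 \<Longrightarrow> c b0 \<le> f a"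
    by metis
  define C where "C = (\<Sum>b\<in>B. 1 / c b)"
  have cC: "1 / c b \<le> C" if "b \<in> B" for b
    unfolding C_def using fB that c(1) by (intro member_le_sum) (auto simp: less_imp_le)
  have "\<exists>a. w = (\<Sum>b\<in>B. a b *\<^sub>R b) \<and> (\<forall>b\<in>B. \<bar>a b\<bar> \<le> C * norm w)" for w
  proof -
    have "w \<in> span B" using spB by auto
    then obtain a where a: "w = (\<Sum>b\<in>B. a b *\<^sub>R b)" using span_finite [OF fB] by auto
    show ?thesis
    proof (cases "w = 0")
      case True
      then show ?thesis by (intro exI [of _ "\<lambda>_. 0"]) auto
    next
      case False
      then have "B \<noteq> {}" using a by auto
      \<comment> \<open>Dividing by the largest coefficient, nonzero because \<open>w\<close> is,
        gives an element of \<open>K b0\<close>.\<close>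
      then have "Max ((\<lambda>b. \<bar>a b\<bar>) ` B) \<in> (\<lambda>b. \<bar>a b\<bar>) ` B" using fB by (intro Max_in) auto
      then obtain b0 where b0: "b0 \<in> B" "Max ((\<lambda>b. \<bar>a b\<bar>) ` B) = \<bar>a b0\<bar>" by blast
      have b0m: "\<bar>a b\<bar> \<le> \<bar>a b0\<bar>" if "b \<in> B" for b
        using Max_ge [of "(\<lambda>b. \<bar>a b\<bar>) ` B" "\<bar>a b\<bar>"] fB that unfolding b0(2) by blast
      have n0: "a b0 \<noteq> 0"
      proof
        assume "a b0 = 0"
        then have "a b = 0" if "b \<in> B" for b using b0m [OF that] by simp
        then have "w = 0" unfolding a by (intro sum.neutral) simp
        then show False using False by simp
      qed
      define a' where "a' b = (if b \<in> B then a b / a b0 else 0)" for b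
      have "\<bar>a' b\<bar> \<le> 1" if "b \<in> B" for b
        using b0m [OF that] n0 that unfolding a'_def by simp
      moreover have "a' b0 = 1" "\<And>b. b \<notin> B \<Longrightarrow> a' b = 0" using n0 b0(1) by (auto simp: a'_def)
      ultimately have "a' \<in> K b0" unfolding K_def by (auto simp: abs_le_iff)
      then have "c b0 \<le> f a'" using c(2) b0(1) by blast
      moreover have "(\<Sum>b\<in>B. a' b *\<^sub>R b) = (1 / a b0) *\<^sub>R w"
        unfolding a a'_def scaleR_sum_right by (intro sum.cong) auto
      ultimately have "c b0 * \<bar>a b0\<bar> \<le> norm w" using n0 by (simp add: f_def field_simps)
      then have "\<bar>a b0\<bar> \<le> 1 / c b0 * norm w" using c(1) b0(1) by (simp add: field_simps)
      also have "\<dots> \<le> C * norm w" using cC b0(1) by (intro mult_right_mono) auto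
      finally have "\<bar>a b\<bar> \<le> C * norm w" if "b \<in> B" for b using b0m [OF that] by simp
      then show ?thesis using a by blast
    qed
  qed
  moreover have "C \<ge> 0" unfolding C_def using c(1) by (intro sum_nonneg) (auto simp: less_imp_le)
  ultimately show thesis using that fB unfolding coord_basis_def by blast
qed

text \<open>The bound involves \<open>T\<close> only through its values on \<open>B\<close>; when
  \<open>T\<close> varies with a point, continuity of these finitely many values controls the
  operator norm locally uniformly.\<close>

lemma coord_basis_linear_bound:
  fixes B :: "'e::real_normed_vector set" and T :: "'e \<Rightarrow> 'f::real_normed_vector"
  assumes "coord_basis B C" "linear T"
  shows "norm (T w) \<le> C * (\<Sum>b\<in>B. norm (T b)) * norm w"
proof -
  obtain a where a: "w = (\<Sum>b\<in>B. a b *\<^sub>R b)" "\<forall>b\<in>B. \<bar>a b\<bar> \<le> C * norm w"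
    using assms(1) unfolding coord_basis_def by blast
  have "T w = (\<Sum>b\<in>B. a b *\<^sub>R T b)"
    by (subst a(1)) (simp add: linear_sum [OF assms(2)] linear_scale [OF assms(2)])
  also have "norm \<dots> \<le> (\<Sum>b\<in>B. (C * norm w) * norm (T b))"
    by (intro order_trans [OF norm_sum] sum_mono) (simp add: a(2) mult_right_mono)
  finally show ?thesis by (simp add: sum_distrib_left sum_distrib_right mult_ac)
qed

lemma coord_basis_bilinear_bound:
  fixes B :: "'e::real_normed_vector set" and T :: "'e \<Rightarrow> 'e \<Rightarrow> 'f::real_normed_vector"
  assumes bas: "coord_basis B C" and l1: "\<And>y. linear (\<lambda>x. T x y)" and l2: "\<And>x. linear (T x)"
  shows "norm (T a b) \<le> C * C * (\<Sum>j\<in>B. \<Sum>i\<in>B. norm (T i j)) * norm a * norm b"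
proof -
  have C0: "C \<ge> 0" using bas by (simp add: coord_basis_def)
  have "norm (T a b) \<le> C * (\<Sum>j\<in>B. norm (T a j)) * norm b"
    by (rule coord_basis_linear_bound [OF bas l2])
  also have "\<dots> \<le> C * (\<Sum>j\<in>B. C * (\<Sum>i\<in>B. norm (T i j)) * norm a) * norm b"
    using C0 by (intro mult_right_mono mult_left_mono sum_mono coord_basis_linear_bound [OF bas l1]) auto
  also have "\<dots> = C * C * (\<Sum>j\<in>B. \<Sum>i\<in>B. norm (T i j)) * norm a * norm b"
    by (simp add: sum_distrib_left sum_distrib_right mult_ac)
  finally show ?thesis .
qed

lemma coord_basis_bounded_bilinear:
  fixes B :: "'e::real_normed_vector set" and T :: "'e \<Rightarrow> 'e \<Rightarrow> 'f::real_normed_vector"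
  assumes bas: "coord_basis B C" and l1: "\<And>y. linear (\<lambda>x. T x y)" and l2: "\<And>x. linear (T x)"
  shows "bounded_bilinear T"
proof
  show "\<exists>K. \<forall>a b. norm (T a b) \<le> norm a * norm b * K"
    using coord_basis_bilinear_bound [OF assms]
    by (intro exI [of _ "C * C * (\<Sum>j\<in>B. \<Sum>i\<in>B. norm (T i j))"] allI) (simp add: mult_ac)
qed (simp_all add: linear_add [OF l1] linear_scale [OF l1] linear_add [OF l2] linear_scale [OF l2])

section \<open>Smooth maps and local uniqueness of solution curves\<close>

lemma isCont_nhds_iff: "isCont f x \<longleftrightarrow> (f \<longlongrightarrow> f x) (nhds x)"
  by (simp add: continuous_at tendsto_at_iff_tendsto_nhds)

lemma C_n_on_SucD:
  assumes "C_n_on (Suc n) S f"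
  shows "\<And>x. x \<in> S \<Longrightarrow> (f has_derivative frechet_derivative f (at x)) (at x)"
    and "\<And>v. C_n_on n S (\<lambda>x. frechet_derivative f (at x) v)"
  using assms by (auto simp: frechet_derivative_works)

lemma smooth_onD:
  assumes "smooth_on S f"
  shows "\<And>x. x \<in> S \<Longrightarrow> (f has_derivative frechet_derivative f (at x)) (at x)"
    and "\<And>v. smooth_on S (\<lambda>x. frechet_derivative f (at x) v)"
    and "continuous_on S f"
proof -
  have *: "C_n_on n S f" for n using assms by (simp add: smooth_on_def)
  show "\<And>x. x \<in> S \<Longrightarrow> (f has_derivative frechet_derivative f (at x)) (at x)"
    using C_n_on_SucD(1) [OF *] .
  show "\<And>v. smooth_on S (\<lambda>x. frechet_derivative f (at x) v)"
    unfolding smooth_on_def using C_n_on_SucD(2) [OF *] by blast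
  show "continuous_on S f" using * [of 0] by simp
qed

text \<open>The sum \<open>s\<close> of the norms of the derivatives along \<open>B\<close> is
  continuous, so it stays below \<open>s z + 1\<close> on a ball, where the mean value inequality
  applies.\<close>

lemma smooth_on_local_Lipschitz:
  fixes B :: "'e::real_normed_vector set" and f :: "'e \<Rightarrow> 'f::real_normed_vector"
  assumes bas: "coord_basis B C" and U: "open U" "z \<in> U" and f: "smooth_on U f"
  obtains d L where "d > 0" "ball z d \<subseteq> U" "L > 0"
    "\<And>a b. a \<in> ball z d \<Longrightarrow> b \<in> ball z d \<Longrightarrow> norm (f a - f b) \<le> L * norm (a - b)"
proof -
  define D where "D x = frechet_derivative f (at x)" for x
  define s where "s x = (\<Sum>b\<in>B. norm (D x b))" for x
  have "continuous_on U s" unfolding s_def D_def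
    by (intro continuous_intros smooth_onD(3) smooth_onD(2) f)
  then have "isCont s z" using U continuous_on_eq_continuous_at by blast
  then have "\<forall>\<^sub>F x in nhds z. s x < s z + 1"
    unfolding isCont_nhds_iff by (rule order_tendstoD(2)) simp
  moreover have "\<forall>\<^sub>F x in nhds z. x \<in> U" using U by (rule eventually_nhds_in_open)
  ultimately have "\<forall>\<^sub>F x in nhds z. x \<in> U \<and> s x < s z + 1" by (simp add: eventually_conj_iff)
  then obtain d where d: "d > 0" "\<And>x. x \<in> ball z d \<Longrightarrow> x \<in> U \<and> s x < s z + 1"
    by (auto simp: eventually_nhds_metric dist_commute)
  have C0: "C \<ge> 0" using bas by (simp add: coord_basis_def)
  have s0: "s x \<ge> 0" for x unfolding s_def by (intro sum_nonneg) auto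
  have "norm (f a - f b) \<le> (C * (s z + 1)) * norm (a - b)" if "a \<in> ball z d" "b \<in> ball z d" for a b
  proof (rule differentiable_bound [OF convex_ball [of z d] _ _ that])
    fix x assume x: "x \<in> ball z d"
    have "(f has_derivative D x) (at x)"
      unfolding D_def using d(2) [OF x] by (intro smooth_onD(1) [OF f]) simp
    then show dx: "(f has_derivative D x) (at x within ball z d)"
      by (rule has_derivative_at_withinI)
    show "onorm (D x) \<le> C * (s z + 1)"
    proof (rule onorm_bound)
      fix w
      have "norm (D x w) \<le> C * s x * norm w" unfolding s_def
        by (rule coord_basis_linear_bound [OF bas has_derivative_linear [OF dx]])
      also have "\<dots> \<le> C * (s z + 1) * norm w"
        using d(2) [OF x] C0 by (auto intro!: mult_right_mono mult_left_mono)
      finally show "norm (D x w) \<le> C * (s z + 1) * norm w" .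
    qed (use C0 s0 in simp)
  qed
  \<comment> \<open>Adding 1 keeps the Lipschitz constant positive even when
    \<open>C = 0\<close>.\<close>
  then have "norm (f a - f b) \<le> (C * (s z + 1) + 1) * norm (a - b)"
    if "a \<in> ball z d" "b \<in> ball z d" for a b
    by (rule order_trans [OF _ mult_right_mono]) (use that in auto)
  moreover have "C * (s z + 1) + 1 > 0" using C0 s0 by (simp add: add_nonneg_pos)
  ultimately show thesis using that [of d "C * (s z + 1) + 1"] d(1) d(2) by (meson subsetI)
qed

text \<open>A contraction argument without integrals: on an interval of radius \<open>h\<close> with
  \<open>L * h \<le> 1 / 2\<close>, the mean value inequality bounds the maximum of the norm of
  \<open>u - w\<close> by half of itself.\<close>

lemma ode_local_unique:
  fixes f :: "'e::real_normed_vector \<Rightarrow> 'e" and u w :: "real \<Rightarrow> 'e"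
  assumes d: "d > 0" "L > 0"
    and lip: "\<And>a b. a \<in> ball z d \<Longrightarrow> b \<in> ball z d \<Longrightarrow> norm (f a - f b) \<le> L * norm (a - b)"
    and u: "u t0 = z" "\<forall>\<^sub>F t in nhds t0. (u has_vector_derivative f (u t)) (at t)"
    and w: "w t0 = z" "\<forall>\<^sub>F t in nhds t0. (w has_vector_derivative f (w t)) (at t)"
  shows "\<forall>\<^sub>F t in nhds t0. u t = w t"
proof -
  have ball: "\<forall>\<^sub>F t in nhds t0. g t \<in> ball z d"
    if "g t0 = z" "\<forall>\<^sub>F t in nhds t0. (g has_vector_derivative f (g t)) (at t)" for g
  proof -
    have "isCont g t0" using eventually_nhds_x_imp_x [OF that(2)] has_vector_derivative_continuous by blast
    then have "(g \<longlongrightarrow> z) (nhds t0)"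
      using that(1) isCont_nhds_iff by metis
    then show ?thesis using d(1) by (intro topological_tendstoD) auto
  qed
  have "\<forall>\<^sub>F t in nhds t0. (u has_vector_derivative f (u t)) (at t) \<and> u t \<in> ball z d
      \<and> (w has_vector_derivative f (w t)) (at t) \<and> w t \<in> ball z d"
    using u(2) w(2) ball [OF u] ball [OF w] by (simp add: eventually_conj_iff)
  then obtain r where r: "r > 0" "\<And>t. dist t t0 < r \<Longrightarrow> (u has_vector_derivative f (u t)) (at t) \<and> u t \<in> ball z d
      \<and> (w has_vector_derivative f (w t)) (at t) \<and> w t \<in> ball z d"
    by (auto simp: eventually_nhds_metric)
  define h where "h = min (r / 2) (1 / (2 * L))"
  have h: "h > 0" "h < r" "L * h \<le> 1 / 2" using r(1) d(2) by (auto simp: h_def min_def field_simps)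
  define g where "g t = u t - w t" for t
  have g': "(g has_derivative (\<lambda>s. s *\<^sub>R (f (u t) - f (w t)))) (at t within S)" if "t \<in> cball t0 h" for t S
  proof -
    have "((\<lambda>t. u t - w t) has_vector_derivative (f (u t) - f (w t))) (at t)"
      using r(2) [of t] that h(2) by (intro has_vector_derivative_diff) (auto simp: dist_commute)
    then show ?thesis unfolding g_def has_vector_derivative_def by (rule has_derivative_at_withinI)
  qed
  have "continuous_on (cball t0 h) (\<lambda>t. norm (g t))"
    using g' by (intro continuous_on_norm has_derivative_continuous_on) blast
  then obtain m where m: "m \<in> cball t0 h" "\<And>t. t \<in> cball t0 h \<Longrightarrow> norm (g t) \<le> norm (g m)"
    using continuous_attains_sup [OF compact_cball, of t0 h "\<lambda>t. norm (g t)"] h(1) by auto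
  have "norm (g m - g t0) \<le> (L * norm (g m)) * norm (m - t0)"
  proof (rule differentiable_bound [OF convex_cball g' _ m(1)])
    fix t assume t: "t \<in> cball t0 h"
    have "norm (f (u t) - f (w t)) \<le> L * norm (g t)"
      unfolding g_def using r(2) [of t] t h(2) by (intro lip) (auto simp: dist_commute)
    also have "\<dots> \<le> L * norm (g m)" using m(2) [OF t] d(2) by simp
    finally show "onorm (\<lambda>s. s *\<^sub>R (f (u t) - f (w t))) \<le> L * norm (g m)"
      using d(2) by (intro onorm_bound) (auto simp: mult.commute mult_left_mono)
  qed (use h in auto)
  also have "\<dots> \<le> (L * norm (g m)) * h"
    using m(1) d(2) by (intro mult_left_mono) (auto simp: dist_norm norm_minus_commute)
  also have "\<dots> \<le> 1 / 2 * norm (g m)" using mult_right_mono [OF h(3), of "norm (g m)"] by (simp add: mult_ac)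
  finally have "norm (g m) \<le> 0" using u(1) w(1) by (simp add: g_def)
  then have "g t = 0" if "t \<in> cball t0 h" for t using m(2) [OF that] by simp
  then show ?thesis using h(1) unfolding eventually_nhds_metric g_def
    by (intro exI [of _ h]) (auto simp: dist_commute)
qed

section \<open>Second-order expansion of a smooth map on a product\<close>

text \<open>The second partial derivative across the two slots. For a group multiplication at the
  identity it is the bilinear Taylor term.\<close>

definition mixed_deriv ::
    "('e::real_normed_vector \<times> 'e \<Rightarrow> 'f::real_normed_vector) \<Rightarrow> 'e \<times> 'e \<Rightarrow> 'e \<Rightarrow> 'e \<Rightarrow> 'f" where
  "mixed_deriv M p a b = frechet_derivative (\<lambda>q. frechet_derivative M (at q) (0, b)) (at p) (a, 0)"

text \<open>In \<open>a\<close> this is linearity of a derivative. In \<open>b\<close>, the inner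
  derivatives are additive and homogeneous throughout the open set \<open>U\<close>, so their
  derivatives at \<open>p\<close> are too.\<close>

lemma linear_mixed_deriv:
  assumes "open U" "p \<in> U" "smooth_on U M"
  shows "linear (\<lambda>a. mixed_deriv M p a b)" and "linear (mixed_deriv M p a)"
proof -
  define D where "D b q = frechet_derivative M (at q) (0, b)" for b q
  have D: "smooth_on U (D b)" for b unfolding D_def by (rule smooth_onD(2) [OF assms(3)])
  have D': "(D b has_derivative frechet_derivative (D b) (at p)) (at p)" for b
    by (rule smooth_onD(1) [OF D assms(2)])
  have m: "mixed_deriv M p a b = frechet_derivative (D b) (at p) (a, 0)" for a b
    unfolding mixed_deriv_def D_def ..
  have lin1: "linear (frechet_derivative (D b) (at p))" for b by (rule has_derivative_linear [OF D'])
  show "linear (\<lambda>a. mixed_deriv M p a b)"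
    unfolding m using linear_compose [OF _ lin1, of "\<lambda>a. (a, 0)" b]
    by (simp add: o_def linear_iff zero_prod_def [symmetric] scaleR_prod_def)
  have lin2: "linear (frechet_derivative M (at q))" if "q \<in> U" for q
    by (rule has_derivative_linear [OF smooth_onD(1) [OF assms(3) that]])
  have Dadd: "D (b + b') q = D b q + D b' q" if "q \<in> U" for b b' q
    using linear_add [OF lin2 [OF that], of "(0, b)" "(0, b')"] by (simp add: D_def)
  have Dscale: "D (r *\<^sub>R b) q = r *\<^sub>R D b q" if "q \<in> U" for b r q
    using linear_scale [OF lin2 [OF that], of r "(0, b)"] by (simp add: D_def)
  show "linear (mixed_deriv M p a)"
  proof (rule linearI)
    fix b b'
    have "((\<lambda>q. D b q + D b' q) has_derivative frechet_derivative (D (b + b')) (at p)) (at p)"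
      by (rule has_derivative_transform_within_open [OF D' assms(1,2)]) (rule Dadd)
    then have "frechet_derivative (D (b + b')) (at p)
        = (\<lambda>v. frechet_derivative (D b) (at p) v + frechet_derivative (D b') (at p) v)"
      by (rule has_derivative_unique) (rule has_derivative_add [OF D' D'])
    then show "mixed_deriv M p a (b + b') = mixed_deriv M p a b + mixed_deriv M p a b'"
      by (simp add: m)
  next
    fix r b
    have "((\<lambda>q. r *\<^sub>R D b q) has_derivative frechet_derivative (D (r *\<^sub>R b)) (at p)) (at p)"
      by (rule has_derivative_transform_within_open [OF D' assms(1,2)]) (rule Dscale)
    then have "frechet_derivative (D (r *\<^sub>R b)) (at p) = (\<lambda>v. r *\<^sub>R frechet_derivative (D b) (at p) v)"
      by (rule has_derivative_unique) (rule has_derivative_scaleR_right [OF D'])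
    then show "mixed_deriv M p a (r *\<^sub>R b) = r *\<^sub>R mixed_deriv M p a b" by (simp add: m)
  qed
qed

text \<open>The mean value inequality is applied twice, once per slot. The product form of the error
  lets later estimates measure it against one argument alone.\<close>

lemma mixed_second_difference:
  fixes M :: "'e::real_normed_vector \<times> 'e \<Rightarrow> 'f::real_normed_vector" and B :: "'e set"
  assumes bas: "coord_basis B C" and U: "open U" "(z, z) \<in> U" and M: "smooth_on U M" and \<epsilon>: "\<epsilon> > 0"
  obtains d where "d > 0" "\<And>a b. norm a < d \<Longrightarrow> norm b < d \<Longrightarrow>
    norm (M (z + a, z + b) - M (z + a, z) - M (z, z + b) + M (z, z) - mixed_deriv M (z, z) a b)
      \<le> \<epsilon> * norm a * norm b"
proof -
  define D where "D b q = frechet_derivative M (at q) (0, b)" for b q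
  have D: "smooth_on U (D b)" for b unfolding D_def by (rule smooth_onD(2) [OF M])
  have D': "(D b has_derivative frechet_derivative (D b) (at p)) (at p)" if "p \<in> U" for b p
    by (rule smooth_onD(1) [OF D that])
  have M': "(M has_derivative frechet_derivative M (at p)) (at p)" if "p \<in> U" for p
    by (rule smooth_onD(1) [OF M that])
  have m: "mixed_deriv M p a b = frechet_derivative (D b) (at p) (a, 0)" for a b p
    unfolding mixed_deriv_def D_def ..
  define E where "E = mixed_deriv M (z, z)"
  have linE: "linear (\<lambda>a. E a b)" "linear (E a)" for a b
    unfolding E_def by (rule linear_mixed_deriv [OF U M])+
  interpret E: bounded_bilinear E by (rule coord_basis_bounded_bilinear [OF bas linE])
  \<comment> \<open>\<open>s p\<close> bounds the bilinear map \<open>mixed_deriv M p - E\<close>;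
    it is continuous and vanishes at \<open>(z, z)\<close>.\<close>
  define s where "s p = C * C * (\<Sum>j\<in>B. \<Sum>i\<in>B. norm (mixed_deriv M p i j - E i j))" for p
  have "continuous_on U s" unfolding s_def m
    by (intro continuous_intros smooth_onD(3) [OF smooth_onD(2) [OF D]])
  then have "isCont s (z, z)" using U continuous_on_eq_continuous_at by blast
  moreover have "s (z, z) = 0" by (simp add: s_def E_def)
  ultimately have "\<forall>\<^sub>F p in nhds (z, z). s p < \<epsilon>"
    unfolding isCont_nhds_iff using \<epsilon> order_tendstoD(2) by fastforce
  moreover have "\<forall>\<^sub>F p in nhds (z, z). p \<in> U" using U by (rule eventually_nhds_in_open)
  ultimately have "\<forall>\<^sub>F p in nhds (z, z). p \<in> U \<and> s p < \<epsilon>" by (simp add: eventually_conj_iff)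
  then obtain P Q where P: "eventually P (nhds z)" and Q: "eventually Q (nhds z)"
    and PQ: "\<And>a b. P a \<Longrightarrow> Q b \<Longrightarrow> (a, b) \<in> U \<and> s (a, b) < \<epsilon>"
    unfolding nhds_prod eventually_prod_filter by blast
  have "eventually (\<lambda>a. P a \<and> Q a) (nhds z)" using P Q by (simp add: eventually_conj_iff)
  then obtain d where d: "d > 0" "\<And>a. dist a z < d \<Longrightarrow> P a \<and> Q a"
    by (auto simp: eventually_nhds_metric)
  have near: "(z + a, z + b) \<in> U \<and> s (z + a, z + b) < \<epsilon>" if "norm a < d" "norm b < d" for a b
    using that d(2) [of "z + a"] d(2) [of "z + b"] by (intro PQ) (simp_all add: dist_norm)
  have z0: "(0::'e) \<in> ball 0 d" using d(1) by simp
  have inner: "norm (D w (z + a, z + b) - D w (z, z + b) - E a w) \<le> \<epsilon> * norm w * norm a"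
    if a: "norm a < d" and b: "norm b < d" for a b w
  proof -
    define k where "k a = D w (z + a, z + b) - E a w" for a
    have "norm (k a - k 0) \<le> (\<epsilon> * norm w) * norm (a - 0)"
    proof (rule differentiable_bound [OF convex_ball [of 0 d]])
      fix y :: 'e assume y: "y \<in> ball 0 d"
      then have pU: "(z + y, z + b) \<in> U" and s: "s (z + y, z + b) < \<epsilon>" using near b by auto
      show "(k has_derivative (\<lambda>v. mixed_deriv M (z + y, z + b) v w - E v w)) (at y within ball 0 d)"
      proof -
        have "((\<lambda>y. (z + y, z + b)) has_derivative (\<lambda>v. (v, 0))) (at y within ball 0 d)"
          by (auto intro!: derivative_eq_intros)
        from has_derivative_compose [where g = "D w", OF this D' [OF pU]] show ?thesis
          unfolding k_def m by (intro has_derivative_diff bounded_linear_imp_has_derivative E.bounded_linear_left)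
      qed
      show "onorm (\<lambda>v. mixed_deriv M (z + y, z + b) v w - E v w) \<le> \<epsilon> * norm w"
      proof (rule onorm_bound)
        fix v
        have "norm (mixed_deriv M (z + y, z + b) v w - E v w) \<le> s (z + y, z + b) * norm v * norm w"
          unfolding s_def
          by (rule coord_basis_bilinear_bound [OF bas])
             (intro linear_compose_sub linear_mixed_deriv [OF U(1) pU M] linE)+
        also have "\<dots> \<le> \<epsilon> * norm v * norm w" using s by (intro mult_right_mono) auto
        finally show "norm (mixed_deriv M (z + y, z + b) v w - E v w) \<le> \<epsilon> * norm w * norm v"
          by (simp add: mult_ac)
      qed (use \<epsilon> in simp)
    qed (use a z0 in auto)
    then show ?thesis by (simp add: k_def E.zero_left algebra_simps)
  qed
  have "norm (M (z + a, z + b) - M (z + a, z) - M (z, z + b) + M (z, z) - E a b) \<le> \<epsilon> * norm a * norm b"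
    if a: "norm a < d" and b: "norm b < d" for a b
  proof -
    \<comment> \<open>The derivative of \<open>h\<close> is exactly the quantity that
      \<open>inner\<close> bounds.\<close>
    define h where "h b = M (z + a, z + b) - M (z, z + b) - E a b" for b
    have "norm (h b - h 0) \<le> (\<epsilon> * norm a) * norm (b - 0)"
    proof (rule differentiable_bound [OF convex_ball [of 0 d]])
      fix y :: 'e assume y: "y \<in> ball 0 d"
      then have pU: "(z + a, z + y) \<in> U" and qU: "(z, z + y) \<in> U" using near [of a y] near [of 0 y] a d(1) by auto
      show "(h has_derivative (\<lambda>w. D w (z + a, z + y) - D w (z, z + y) - E a w)) (at y within ball 0 d)"
      proof -
        have pair: "((\<lambda>y. (c, z + y)) has_derivative (\<lambda>v. (0, v))) (at y within ball 0 d)" for c :: 'e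
          by (auto intro!: derivative_eq_intros)
        from has_derivative_compose [where g = M, OF pair M' [OF pU]]
          has_derivative_compose [where g = M, OF pair M' [OF qU]]
        show ?thesis
          unfolding h_def D_def by (intro has_derivative_diff bounded_linear_imp_has_derivative E.bounded_linear_right)
      qed
      show "onorm (\<lambda>w. D w (z + a, z + y) - D w (z, z + y) - E a w) \<le> \<epsilon> * norm a"
      proof (rule onorm_bound)
        show "norm (D w (z + a, z + y) - D w (z, z + y) - E a w) \<le> \<epsilon> * norm a * norm w" for w
          using inner [of a y w] a y by (simp add: mult_ac)
      qed (use \<epsilon> in simp)
    qed (use b z0 in auto)
    then show ?thesis by (simp add: h_def E.zero_right algebra_simps)
  qed
  then show thesis using d(1) unfolding E_def by (rule that [rotated])
qed

section \<open>Coordinates on a Lie group and integral curves\<close>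

lemma C_n_on_cong:
  assumes "open S" "\<And>x. x \<in> S \<Longrightarrow> f x = g x" "C_n_on n S f"
  shows "C_n_on n S g"
  using assms(2,3)
proof (induction n arbitrary: f g)
  case 0
  then show ?case using continuous_on_cong [of S S f g] by auto
next
  case (Suc n)
  have g': "(g has_derivative frechet_derivative f (at x)) (at x)" if "x \<in> S" for x
    by (rule has_derivative_transform_within_open [OF C_n_on_SucD(1) [OF Suc.prems(2) that] assms(1) that])
      (rule Suc.prems(1))
  show ?case unfolding C_n_on.simps
  proof (intro conjI ballI allI)
    show "g differentiable at x" if "x \<in> S" for x using g' [OF that] by (rule differentiableI)
    show "C_n_on n S (\<lambda>x. frechet_derivative g (at x) v)" for v
    proof (rule Suc.IH [OF _ C_n_on_SucD(2) [OF Suc.prems(2), of v]])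
      show "frechet_derivative f (at x) v = frechet_derivative g (at x) v" if "x \<in> S" for x
        using frechet_derivative_at [OF g' [OF that]] by simp
    qed
  qed
qed

lemma smooth_on_cong:
  assumes "open S" "\<And>x. x \<in> S \<Longrightarrow> f x = g x" "smooth_on S f"
  shows "smooth_on S g"
  unfolding smooth_on_def
proof
  show "C_n_on n S g" for n
    using assms(3) by (intro C_n_on_cong [OF assms(1,2)]) (auto simp: smooth_on_def)
qed

lemma has_derivative_cong_nhds:
  assumes "(f has_derivative f') (at x)" "\<forall>\<^sub>F y in nhds x. f y = g y"
  shows "(g has_derivative f') (at x)"
proof -
  obtain S where S: "open S" "x \<in> S" "\<forall>y\<in>S. f y = g y" using assms(2) unfolding eventually_nhds by auto
  from S(1,2) bspec [OF S(3)] show ?thesis by (rule has_derivative_transform_within_open [OF assms(1)])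
qed

lemma has_vector_derivative_cong_nhds:
  assumes "(f has_vector_derivative f') (at x)" "\<forall>\<^sub>F y in nhds x. f y = g y"
  shows "(g has_vector_derivative f') (at x)"
  using assms unfolding has_vector_derivative_def by (rule has_derivative_cong_nhds)

lemma openI_nhds:
  assumes "\<And>x. x \<in> S \<Longrightarrow> \<forall>\<^sub>F y in nhds x. y \<in> S"
  shows "open S"
  unfolding open_subopen [of S]
proof
  fix x assume "x \<in> S"
  then have "\<exists>T. open T \<and> x \<in> T \<and> (\<forall>y\<in>T. y \<in> S)" using assms unfolding eventually_nhds by simp
  then show "\<exists>T. open T \<and> x \<in> T \<and> T \<subseteq> S" by blast
qed

lemma continuous_on_UNIV_tendsto:
  assumes "continuous_on UNIV f" "(g \<longlongrightarrow> l) F"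
  shows "((\<lambda>x. f (g x)) \<longlongrightarrow> f l) F"
  by (rule continuous_on_tendsto_compose [OF assms]) auto

context lie_group
begin

section \<open>Charts and continuity of the group operations\<close>

abbreviation cinv :: "('g, 'e) chart \<Rightarrow> 'e \<Rightarrow> 'g" where "cinv \<equiv> chart_inv"

lemma basis_exists: obtains B :: "'e set" and C where "coord_basis B C"
proof -
  obtain B :: "'e set" where "finite B" "span B = UNIV" using atlas unfolding smooth_atlas_def by blast
  then show thesis by (rule coord_basis_exists) (rule that)
qed

lemma chart_at: obtains c where "c \<in> charts" "p \<in> fst c"
proof -
  have "p \<in> (\<Union>c\<in>charts. fst c)" using atlas unfolding smooth_atlas_def by blast
  then show thesis using that by blast
qed

lemma
  assumes "c \<in> charts"
  shows open_chart: "open (fst c)"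
    and open_chart_image: "open (snd c ` fst c)"
    and chart_homeo: "homeomorphism (fst c) (snd c ` fst c) (snd c) (cinv c)"
    and chart_continuous: "continuous_on (fst c) (snd c)"
    and cinv_continuous: "continuous_on (snd c ` fst c) (cinv c)"
    and cinv_chart: "p \<in> fst c \<Longrightarrow> cinv c (snd c p) = p"
    and chart_cinv: "a \<in> snd c ` fst c \<Longrightarrow> snd c (cinv c a) = a"
    and cinv_in: "a \<in> snd c ` fst c \<Longrightarrow> cinv c a \<in> fst c"
    and chart_inj: "inj_on (snd c) (fst c)"
proof -
  show h: "homeomorphism (fst c) (snd c ` fst c) (snd c) (cinv c)" "open (fst c)" "open (snd c ` fst c)"
    using atlas assms unfolding smooth_atlas_def by blast+
  show "continuous_on (fst c) (snd c)" "continuous_on (snd c ` fst c) (cinv c)"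
    "p \<in> fst c \<Longrightarrow> cinv c (snd c p) = p" "a \<in> snd c ` fst c \<Longrightarrow> snd c (cinv c a) = a"
    "a \<in> snd c ` fst c \<Longrightarrow> cinv c a \<in> fst c"
    using h(1) by (auto simp: homeomorphism_def)
  show "inj_on (snd c) (fst c)"
    using h(1) unfolding homeomorphism_def by (intro inj_on_inverseI [of _ "cinv c"]) blast
qed

lemma chart_tendsto:
  assumes "c \<in> charts" "p \<in> fst c" "(f \<longlongrightarrow> p) F"
  shows "((\<lambda>x. snd c (f x)) \<longlongrightarrow> snd c p) F" and "\<forall>\<^sub>F x in F. f x \<in> fst c"
proof -
  show *: "\<forall>\<^sub>F x in F. f x \<in> fst c"
    using topological_tendstoD [OF assms(3) open_chart [OF assms(1)] assms(2)] .
  show "((\<lambda>x. snd c (f x)) \<longlongrightarrow> snd c p) F"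
    by (rule continuous_on_tendsto_compose [OF chart_continuous [OF assms(1)] assms(3,2) *])
qed

lemma continuous_gmul: "continuous_on UNIV (\<lambda>(x, y). gmul x y)"
  using smooth_mult unfolding smooth_map_on_def by blast

lemma continuous_ginv: "continuous_on UNIV ginv"
  using smooth_ginv unfolding smooth_map_on_def by blast

lemma tendsto_gmul:
  assumes "(f \<longlongrightarrow> a) F" "(g \<longlongrightarrow> b) F"
  shows "((\<lambda>x. gmul (f x) (g x)) \<longlongrightarrow> gmul a b) F"
  using continuous_on_UNIV_tendsto [OF continuous_gmul tendsto_Pair [OF assms]] by simp

lemma tendsto_ginv: "(f \<longlongrightarrow> a) F \<Longrightarrow> ((\<lambda>x. ginv (f x)) \<longlongrightarrow> ginv a) F"
  by (rule continuous_on_UNIV_tendsto [OF continuous_ginv])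

section \<open>Multiplication and left translation in coordinates\<close>

definition mul_coord :: "('g, 'e) chart \<Rightarrow> ('g, 'e) chart \<Rightarrow> ('g, 'e) chart \<Rightarrow> 'e \<times> 'e \<Rightarrow> 'e" where
  "mul_coord b c d = (\<lambda>(a1, a2). snd d (gmul (cinv b a1) (cinv c a2)))"

definition mul_dom :: "('g, 'e) chart \<Rightarrow> ('g, 'e) chart \<Rightarrow> ('g, 'e) chart \<Rightarrow> ('e \<times> 'e) set" where
  "mul_dom b c d = {(a1, a2). a1 \<in> snd b ` fst b \<and> a2 \<in> snd c ` fst c \<and> gmul (cinv b a1) (cinv c a2) \<in> fst d}"

lemma open_mul_dom:
  assumes "b \<in> charts" "c \<in> charts" "d \<in> charts"
  shows "open (mul_dom b c d)"
proof -
  define U where "U = (snd b ` fst b) \<times> (snd c ` fst c)"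
  have "open U" unfolding U_def by (intro open_Times open_chart_image assms)
  have "continuous_on U (\<lambda>x. (cinv b (fst x), cinv c (snd x)))" unfolding U_def
    by (intro continuous_on_Pair continuous_on_compose2 [OF cinv_continuous [OF assms(1)]]
        continuous_on_compose2 [OF cinv_continuous [OF assms(2)]] continuous_on_fst continuous_on_snd
        continuous_on_id) auto
  then have "continuous_on U (\<lambda>x. gmul (cinv b (fst x)) (cinv c (snd x)))"
    using continuous_on_compose2 [OF continuous_gmul] by fastforce
  then have "open (U \<inter> (\<lambda>x. gmul (cinv b (fst x)) (cinv c (snd x))) -` fst d)"
    using continuous_on_open_vimage [OF \<open>open U\<close>] open_chart [OF assms(3)] by (metis Int_commute)
  also have "U \<inter> (\<lambda>x. gmul (cinv b (fst x)) (cinv c (snd x))) -` fst d = mul_dom b c d"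
    unfolding U_def mul_dom_def by auto
  finally show ?thesis .
qed

text \<open>Smoothness of the multiplication is given through \<open>product_atlas\<close>; what
  remains is to identify the inverse of a product chart with the pair of inverse charts on
  \<open>mul_dom\<close>.\<close>

lemma smooth_mul_coord:
  assumes "b \<in> charts" "c \<in> charts" "d \<in> charts"
  shows "smooth_on (mul_dom b c d) (mul_coord b c d)"
proof -
  define bc where "bc = (fst b \<times> fst c, map_prod (snd b) (snd c))"
  have bc: "bc \<in> product_atlas charts charts"
    unfolding product_atlas_def bc_def using assms by blast
  define S where "S = snd bc ` (UNIV \<inter> fst bc \<inter> (\<lambda>(x, y). gmul x y) -` fst d)"
  have sm: "smooth_on S (snd d \<circ> (\<lambda>(x, y). gmul x y) \<circ> chart_inv bc)"
    using smooth_mult bc assms(3) unfolding smooth_map_on_def S_def by blast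
  have S: "S = mul_dom b c d"
  proof
    show "S \<subseteq> mul_dom b c d"
      unfolding S_def mul_dom_def bc_def by (auto simp: assms cinv_chart)
    show "mul_dom b c d \<subseteq> S"
    proof
      fix x assume x: "x \<in> mul_dom b c d"
      then have "x = snd bc (cinv b (fst x), cinv c (snd x))"
        by (auto simp: bc_def mul_dom_def chart_cinv assms)
      moreover have "(cinv b (fst x), cinv c (snd x)) \<in> UNIV \<inter> fst bc \<inter> (\<lambda>(x, y). gmul x y) -` fst d"
        using x by (auto simp: bc_def mul_dom_def cinv_in assms)
      ultimately show "x \<in> S" unfolding S_def by blast
    qed
  qed
  have inj: "inj_on (snd bc) (fst bc)"
    unfolding bc_def using chart_inj assms by (auto intro: map_prod_inj_on)
  have "chart_inv bc x = (cinv b (fst x), cinv c (snd x))" if "x \<in> mul_dom b c d" for x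
  proof -
    have x: "x = snd bc (cinv b (fst x), cinv c (snd x))"
      using that by (auto simp: bc_def mul_dom_def chart_cinv assms)
    have "(cinv b (fst x), cinv c (snd x)) \<in> fst bc"
      using that by (auto simp: bc_def mul_dom_def cinv_in assms)
    then show ?thesis using inv_into_f_f [OF inj] x unfolding chart_inv_def [of bc] by metis
  qed
  then show ?thesis
    by (intro smooth_on_cong [OF open_mul_dom [OF assms] _ sm [unfolded S]])
       (simp add: mul_coord_def split_beta)
qed

text \<open>Left translation by \<open>g\<close> is the multiplication restricted to the slice with
  first factor \<open>g\<close>, so its derivative is a partial derivative in the second
  slot.\<close>

lemma left_translation_has_derivative:
  assumes "c \<in> charts" "d \<in> charts" "p \<in> fst c" "gmul g p \<in> fst d" "b \<in> charts" "g \<in> fst b"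
  shows "((snd d \<circ> gmul g \<circ> cinv c) has_derivative
           (\<lambda>w. frechet_derivative (mul_coord b c d) (at (snd b g, snd c p)) (0, w))) (at (snd c p))"
proof -
  have eq: "snd d \<circ> gmul g \<circ> cinv c = (\<lambda>a. mul_coord b c d (snd b g, a))"
    using assms by (auto simp: mul_coord_def cinv_chart)
  have dom: "(snd b g, snd c p) \<in> mul_dom b c d"
    using assms by (auto simp: mul_dom_def cinv_chart)
  have pair: "((\<lambda>a. (snd b g, a)) has_derivative (\<lambda>w. (0, w))) (at (snd c p))"
    by (auto intro!: derivative_eq_intros)
  show ?thesis unfolding eq
    by (rule has_derivative_compose [where g = "mul_coord b c d", OF pair
          smooth_onD(1) [OF smooth_mul_coord dom]]) (use assms in auto)
qed

lemma left_translation_differentiable: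
  assumes "c \<in> charts" "d \<in> charts" "p \<in> fst c" "gmul g p \<in> fst d"
  shows "(snd d \<circ> gmul g \<circ> cinv c) differentiable at (snd c p)"
proof -
  obtain b where b: "b \<in> charts" "g \<in> fst b" using chart_at .
  show ?thesis by (rule differentiableI [OF left_translation_has_derivative [OF assms b]])
qed

section \<open>Left-invariant fields\<close>

lemma
  assumes "X \<in> lie_algebra gmul charts" "c \<in> charts" "d \<in> charts"
  shows lie_algebra_translate: "p \<in> fst c \<Longrightarrow> gmul g p \<in> fst d \<Longrightarrow>
      X d (gmul g p) = frechet_derivative (snd d \<circ> gmul g \<circ> cinv c) (at (snd c p)) (X c p)"
    and lie_algebra_smooth: "smooth_on (snd c ` fst c) (X c \<circ> cinv c)"
proof -
  have X: "smooth_field charts X" "left_invariant gmul charts X" using assms(1) by (simp_all add: lie_algebra_def)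
  show "smooth_on (snd c ` fst c) (X c \<circ> cinv c)"
    using X(1) assms(2) unfolding smooth_field_def by blast
  show "X d (gmul g p) = frechet_derivative (snd d \<circ> gmul g \<circ> cinv c) (at (snd c p)) (X c p)"
    if "p \<in> fst c" "gmul g p \<in> fst d"
    using X(2) [unfolded left_invariant_def, rule_format, OF assms(2,3) that] .
qed

text \<open>Translation by \<open>p\<close> carries \<open>e\<close> to \<open>p\<close>, so left
  invariance recovers the field from its value at \<open>e\<close>; outside the chart domains both
  fields are 0 by convention.\<close>

lemma lie_algebra_eqI:
  assumes X: "X \<in> lie_algebra gmul charts" and Y: "Y \<in> lie_algebra gmul charts"
    and b: "b \<in> charts" "e \<in> fst b" and eq: "X b e = Y b e"
  shows "X = Y"
proof (intro ext)
  fix c p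
  show "X c p = Y c p"
  proof (cases "c \<in> charts \<and> p \<in> fst c")
    case True
    then show ?thesis
      using lie_algebra_translate [OF X b(1), of c e p] lie_algebra_translate [OF Y b(1), of c e p] b eq by simp
  next
    case False
    then have "Z c p = 0" if "Z \<in> lie_algebra gmul charts" for Z
      using that unfolding lie_algebra_def smooth_field_def by blast
    from this [OF X] this [OF Y] show ?thesis by simp
  qed
qed

section \<open>Integral curves of left-invariant fields\<close>

lemma integral_curveD:
  assumes "integral_curve charts X \<gamma>"
  shows "(\<gamma> \<longlongrightarrow> \<gamma> t) (nhds t)" and "continuous_on UNIV \<gamma>"
    and "c \<in> charts \<Longrightarrow> \<gamma> t \<in> fst c \<Longrightarrow> ((snd c \<circ> \<gamma>) has_vector_derivative X c (\<gamma> t)) (at t)"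
    and "c \<in> charts \<Longrightarrow> \<gamma> t \<in> fst c \<Longrightarrow> \<forall>\<^sub>F s in nhds t. \<gamma> s \<in> fst c"
proof -
  show c: "continuous_on UNIV \<gamma>" using assms by (simp add: integral_curve_def)
  then show *: "(\<gamma> \<longlongrightarrow> \<gamma> t) (nhds t)"
    using isCont_nhds_iff continuous_on_eq_continuous_at by blast
  show "c \<in> charts \<Longrightarrow> \<gamma> t \<in> fst c \<Longrightarrow> ((snd c \<circ> \<gamma>) has_vector_derivative X c (\<gamma> t)) (at t)"
    using assms by (simp add: integral_curve_def)
  show "c \<in> charts \<Longrightarrow> \<gamma> t \<in> fst c \<Longrightarrow> \<forall>\<^sub>F s in nhds t. \<gamma> s \<in> fst c"
    by (rule chart_tendsto(2) [OF _ _ *])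
qed

text \<open>Translations map a left-invariant field to itself, so by the chain rule they preserve
  its integral curves.\<close>

lemma integral_curve_translate:
  assumes X: "X \<in> lie_algebra gmul charts" and \<gamma>: "integral_curve charts X \<gamma>"
  shows "integral_curve charts X (\<lambda>t. gmul g (\<gamma> t))"
  unfolding integral_curve_def
proof (intro conjI allI ballI impI)
  show "continuous_on UNIV (\<lambda>t. gmul g (\<gamma> t))"
    by (auto simp: continuous_on_eq_continuous_at isCont_nhds_iff
        intro!: tendsto_gmul tendsto_const integral_curveD(1) [OF \<gamma>])
  fix t d assume d: "d \<in> charts" "gmul g (\<gamma> t) \<in> fst d"
  obtain c where c: "c \<in> charts" "\<gamma> t \<in> fst c" using chart_at by blast
  define T where "T = snd d \<circ> gmul g \<circ> cinv c"
  have T: "(T has_derivative frechet_derivative T (at (snd c (\<gamma> t)))) (at ((snd c \<circ> \<gamma>) t))"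
    using left_translation_differentiable [OF c(1) d(1) c(2) d(2)]
    by (simp add: T_def frechet_derivative_works)
  define T' where "T' = frechet_derivative T (at (snd c (\<gamma> t)))"
  have "X d (gmul g (\<gamma> t)) = T' (X c (\<gamma> t))"
    unfolding T'_def T_def by (rule lie_algebra_translate [OF X c(1) d(1) c(2) d(2)])
  then have "((\<lambda>s. T ((snd c \<circ> \<gamma>) s)) has_vector_derivative X d (gmul g (\<gamma> t))) (at t)"
    using has_derivative_compose [where g = T, OF integral_curveD(3) [OF \<gamma> c, unfolded has_vector_derivative_def] T]
    unfolding has_vector_derivative_def T'_def [symmetric]
    by (simp only: linear_scale [OF has_derivative_linear [OF T [folded T'_def]]])
  moreover have "\<forall>\<^sub>F s in nhds t. T ((snd c \<circ> \<gamma>) s) = (snd d \<circ> (\<lambda>t. gmul g (\<gamma> t))) s"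
    using integral_curveD(4) [OF \<gamma> c] by eventually_elim (simp add: T_def cinv_chart c(1))
  ultimately show "((snd d \<circ> (\<lambda>t. gmul g (\<gamma> t))) has_vector_derivative X d (gmul g (\<gamma> t))) (at t)"
    by (rule has_vector_derivative_cong_nhds)
qed

lemma integral_curve_rescale:
  assumes "integral_curve charts X \<gamma>"
  shows "integral_curve charts (a *\<^sub>R X) (\<lambda>t. \<gamma> (a * t + s))"
  unfolding integral_curve_def
proof (intro conjI allI ballI impI)
  show "continuous_on UNIV (\<lambda>t. \<gamma> (a * t + s))"
    by (rule continuous_on_compose2 [OF integral_curveD(2) [OF assms]]) (auto intro!: continuous_intros)
  fix t c assume "c \<in> charts" "\<gamma> (a * t + s) \<in> fst c"
  then have "((snd c \<circ> \<gamma>) has_vector_derivative X c (\<gamma> (a * t + s))) (at (a * t + s))"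
    by (rule integral_curveD(3) [OF assms])
  moreover have "((\<lambda>t. a * t + s) has_vector_derivative a) (at t)"
    by (auto intro!: derivative_eq_intros)
  ultimately have "((snd c \<circ> \<gamma> \<circ> (\<lambda>t. a * t + s)) has_vector_derivative a *\<^sub>R X c (\<gamma> (a * t + s))) (at t)"
    by (intro vector_diff_chain_at)
  then show "((snd c \<circ> (\<lambda>t. \<gamma> (a * t + s))) has_vector_derivative (a *\<^sub>R X) c (\<gamma> (a * t + s))) (at t)"
    by (simp add: scaleR_fun_def o_def)
qed

text \<open>The set of times of agreement is closed as the space is Hausdorff, open by
  \<open>ode_local_unique\<close> in a chart, and nonempty; the real line is connected.\<close>

lemma integral_curve_unique:
  assumes X: "X \<in> lie_algebra gmul charts"
    and \<gamma>: "integral_curve charts X \<gamma>" and \<eta>: "integral_curve charts X \<eta>" and "\<gamma> 0 = \<eta> 0"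
  shows "\<gamma> = \<eta>"
proof -
  define S where "S = {t. \<gamma> t = \<eta> t}"
  have "closed S" unfolding S_def
    by (intro closed_Collect_eq integral_curveD(2) [OF \<gamma>] integral_curveD(2) [OF \<eta>])
  moreover have "open S"
  proof (rule openI_nhds)
    fix t0 assume "t0 \<in> S"
    then have t0: "\<gamma> t0 = \<eta> t0" by (simp add: S_def)
    obtain c where c: "c \<in> charts" "\<gamma> t0 \<in> fst c" using chart_at by blast
    define f where "f = X c \<circ> cinv c"
    obtain B :: "'e set" and C where bas: "coord_basis B C" using basis_exists .
    obtain d L where dL: "d > 0" "ball (snd c (\<gamma> t0)) d \<subseteq> snd c ` fst c" "L > 0"
      "\<And>a b. a \<in> ball (snd c (\<gamma> t0)) d \<Longrightarrow> b \<in> ball (snd c (\<gamma> t0)) d \<Longrightarrow> norm (f a - f b) \<le> L * norm (a - b)"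
      by (rule smooth_on_local_Lipschitz [OF bas open_chart_image [OF c(1)] imageI [OF c(2)]
        lie_algebra_smooth [OF X c(1,1), folded f_def]]) (rule that)
    have ode: "\<forall>\<^sub>F t in nhds t0. ((snd c \<circ> \<beta>) has_vector_derivative f ((snd c \<circ> \<beta>) t)) (at t)"
      if "integral_curve charts X \<beta>" "\<beta> t0 \<in> fst c" for \<beta>
      using integral_curveD(4) [OF that(1) c(1) that(2)]
      by eventually_elim (use integral_curveD(3) [OF that(1) c(1)] in \<open>simp add: f_def cinv_chart c(1)\<close>)
    have "\<forall>\<^sub>F t in nhds t0. (snd c \<circ> \<gamma>) t = (snd c \<circ> \<eta>) t"
      by (rule ode_local_unique [OF dL(1,3,4) _ ode [OF \<gamma> c(2)] _ ode [OF \<eta>]]) (simp_all add: c(2) t0 [symmetric])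
    moreover have "\<forall>\<^sub>F t in nhds t0. \<eta> t \<in> fst c" "\<forall>\<^sub>F t in nhds t0. \<gamma> t \<in> fst c"
      using integral_curveD(4) [OF \<gamma> c] integral_curveD(4) [OF \<eta> c(1)] c(2) t0 by auto
    ultimately show "\<forall>\<^sub>F t in nhds t0. t \<in> S"
      by eventually_elim (simp add: S_def inj_on_eq_iff [OF chart_inj [OF c(1)]])
  qed
  moreover have "S \<noteq> {}" using assms(4) by (auto simp: S_def)
  ultimately have "S = UNIV" using clopen [of S] by simp
  then show ?thesis by (auto simp: S_def)
qed

end

section \<open>The exponential map and tangent directions of closed semigroups\<close>

text \<open>Commutator curves are parametrised by a square root, so they have only one-sided
  derivatives at 0, and the estimates deliver these as limits of quotients.\<close>

lemma has_vector_derivative_right_iff: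
  fixes f :: "real \<Rightarrow> 'f::real_normed_vector"
  shows "(f has_vector_derivative D) (at 0 within {0..}) \<longleftrightarrow> ((\<lambda>s. (f s - f 0) /\<^sub>R s) \<longlongrightarrow> D) (at_right 0)"
proof -
  have "\<forall>\<^sub>F s in at_right (0::real). (1 / norm (s - 0)) *\<^sub>R (f s - (f 0 + (s - 0) *\<^sub>R D)) = (f s - f 0) /\<^sub>R s - D"
    using eventually_at_right_less [of 0]
    by eventually_elim (simp add: algebra_simps inverse_eq_divide)
  then have "((\<lambda>s. (1 / norm (s - 0)) *\<^sub>R (f s - (f 0 + (s - 0) *\<^sub>R D))) \<longlongrightarrow> 0) (at_right 0)
      \<longleftrightarrow> ((\<lambda>s. (f s - f 0) /\<^sub>R s - D) \<longlongrightarrow> 0) (at_right 0)"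
    by (rule tendsto_cong)
  then show ?thesis
    unfolding has_vector_derivative_def has_derivative_within
    by (simp add: at_within_Ici_at_right LIM_zero_iff bounded_linear_scaleR_left)
qed

context lie_group
begin

text \<open>The one-parameter subgroup of \<open>X\<close>; the description is known to denote a
  curve once \<open>integral_curve_exists\<close> is available.\<close>

definition flow :: "('g, 'e) field \<Rightarrow> real \<Rightarrow> 'g" where
  "flow X = (THE \<gamma>. integral_curve charts X \<gamma> \<and> \<gamma> 0 = e)"

lemma lie_exp_flow: "lie_exp e charts X = flow X 1"
  by (simp add: lie_exp_def flow_def)

lemma flow_eqI:
  assumes "X \<in> lie_algebra gmul charts" "integral_curve charts X \<gamma>" "\<gamma> 0 = e"
  shows "flow X = \<gamma>"
  unfolding flow_def
proof (rule the_equality)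
  show "\<eta> = \<gamma>" if "integral_curve charts X \<eta> \<and> \<eta> 0 = e" for \<eta>
    using integral_curve_unique [OF assms(1) _ assms(2)] that assms(3) by simp
qed (use assms in simp)

end

locale lie_group_exp = lie_group gmul e ginv charts
  for gmul :: "'g::{t2_space, second_countable_topology} \<Rightarrow> 'g \<Rightarrow> 'g"
    and e ginv and charts :: "('g, 'e::real_normed_vector) chart set" +
  fixes A :: "('g, 'e) field set" and L :: "'e \<Rightarrow> ('g, 'e) field"
  assumes zero_in_A: "0 \<in> A"
    and linear_L: "linear L"
    and bij_L: "bij_betw L UNIV (lie_algebra gmul charts)"
    and exp_diffeo: "diffeo_onto_image (L -` A) model_atlas charts (lie_exp e charts \<circ> L)"
begin

definition exp_dom where "exp_dom = L -` A"

definition exp_L where "exp_L = lie_exp e charts \<circ> L"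

lemma L_in: "L w \<in> lie_algebra gmul charts"
  using bij_L by (auto simp: bij_betw_def)

lemma L_surj: "X \<in> lie_algebra gmul charts \<Longrightarrow> \<exists>w. X = L w"
  using bij_L by (auto simp: bij_betw_def)

lemma subspace_lie_algebra: "subspace (lie_algebra gmul charts)"
  using linear_subspace_image [OF linear_L subspace_UNIV] bij_L by (simp add: bij_betw_def)

lemma zero_in_exp_dom: "0 \<in> exp_dom"
  by (simp add: exp_dom_def linear_0 [OF linear_L] zero_in_A)

lemma
  shows inj_on_exp_L: "inj_on exp_L exp_dom"
    and smooth_exp_L: "smooth_map_on exp_dom model_atlas charts exp_L"
    and smooth_log: "smooth_map_on (exp_L ` exp_dom) charts model_atlas (inv_into exp_dom exp_L)"
  using exp_diffeo unfolding diffeo_onto_image_def exp_dom_def exp_L_def by blast+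

lemma open_exp_dom: "open exp_dom" and continuous_exp_L: "continuous_on exp_dom exp_L"
  using smooth_exp_L unfolding smooth_map_on_def by blast+

lemma small_multiples_in_exp_dom: "\<exists>\<delta>>0. \<forall>t. \<bar>t\<bar> < \<delta> \<longrightarrow> t *\<^sub>R w \<in> exp_dom"
proof -
  have "((\<lambda>t. t *\<^sub>R w) \<longlongrightarrow> 0 *\<^sub>R w) (nhds (0::real))"
    by (intro tendsto_intros) (rule filterlim_ident)
  then have "\<forall>\<^sub>F t in nhds 0. t *\<^sub>R w \<in> exp_dom"
    using open_exp_dom zero_in_exp_dom by (intro topological_tendstoD) auto
  then show ?thesis by (auto simp: eventually_nhds_metric)
qed

text \<open>Completeness comes for free: fields without an integral curve through \<^term>\<open>e\<close> would all share
  the junk value of \<^const>\<open>The\<close> as their exponential, contradicting injectivity.\<close>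

lemma integral_curve_exists:
  assumes X: "X \<in> lie_algebra gmul charts"
  shows "\<exists>\<gamma>. integral_curve charts X \<gamma> \<and> \<gamma> 0 = e"
proof (cases "X = 0")
  case True
  then show ?thesis
    by (intro exI [of _ "\<lambda>_. e"]) (simp add: integral_curve_def o_def has_vector_derivative_const)
next
  case False
  obtain w where w: "X = L w" using L_surj [OF X] by blast
  have w0: "w \<noteq> 0" using False w linear_0 [OF linear_L] by auto
  define curve where "curve Y \<gamma> \<longleftrightarrow> integral_curve charts Y \<gamma> \<and> \<gamma> 0 = e" for Y \<gamma>
  obtain \<delta> where \<delta>: "\<delta> > 0" "\<And>t. \<bar>t\<bar> < \<delta> \<Longrightarrow> t *\<^sub>R w \<in> exp_dom" using small_multiples_in_exp_dom by metis
  define r s where "r = \<delta> / 2" and "s = \<delta> / 3"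
  have rs: "r *\<^sub>R w \<in> exp_dom" "s *\<^sub>R w \<in> exp_dom" "r \<noteq> 0" "s \<noteq> 0" "r *\<^sub>R w \<noteq> s *\<^sub>R w"
    using \<delta> w0 by (auto simp: r_def s_def)
  have "exp_L (r *\<^sub>R w) \<noteq> exp_L (s *\<^sub>R w)" using inj_on_eq_iff [OF inj_on_exp_L rs(1,2)] rs(5) by simp
  moreover have "exp_L (t *\<^sub>R w) = (THE \<gamma>. False) (1::real)" if "\<nexists>\<gamma>. curve (t *\<^sub>R X) \<gamma>" for t
  proof -
    have "exp_L (t *\<^sub>R w) = (THE \<gamma>. curve (t *\<^sub>R X) \<gamma>) 1"
      by (simp add: exp_L_def lie_exp_def w linear_scale [OF linear_L] curve_def)
    moreover have "curve (t *\<^sub>R X) = (\<lambda>\<gamma>. False)" using that by blast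
    ultimately show ?thesis by simp
  qed
  ultimately obtain t \<gamma> where t: "t \<noteq> 0" "curve (t *\<^sub>R X) \<gamma>" using rs(3,4) by metis
  then have "integral_curve charts ((1 / t) *\<^sub>R t *\<^sub>R X) (\<lambda>u. \<gamma> (1 / t * u + 0))"
    unfolding curve_def by (intro integral_curve_rescale) simp
  then show ?thesis using t by (intro exI [of _ "\<lambda>u. \<gamma> (1 / t * u + 0)"]) (simp add: curve_def)
qed

text \<open>The scaling and addition laws are uniqueness of integral curves: for addition, shifting
  the time by \<open>s\<close> and translating from the left by \<open>flow X s\<close> give two
  curves with the same start.\<close>

lemma
  assumes X: "X \<in> lie_algebra gmul charts"
  shows integral_curve_flow: "integral_curve charts X (flow X)"
    and flow_0: "flow X 0 = e"
    and flow_scaleR: "flow (a *\<^sub>R X) t = flow X (a * t)"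
    and flow_add: "flow X (s + t) = gmul (flow X s) (flow X t)"
proof -
  obtain \<gamma> where \<gamma>: "integral_curve charts X \<gamma>" "\<gamma> 0 = e" using integral_curve_exists [OF X] by blast
  have "flow X = \<gamma>" by (rule flow_eqI [OF X \<gamma>])
  then show ic: "integral_curve charts X (flow X)" and 0: "flow X 0 = e" using \<gamma> by simp_all
  have "flow (a *\<^sub>R X) = (\<lambda>t. flow X (a * t + 0))"
    using subspace_scale [OF subspace_lie_algebra X] integral_curve_rescale [OF ic, of a 0] 0
    by (intro flow_eqI) simp_all
  then show "flow (a *\<^sub>R X) t = flow X (a * t)" by simp
  have "(\<lambda>t. flow X (1 * t + s)) = (\<lambda>t. gmul (flow X s) (flow X t))"
    using integral_curve_rescale [OF ic, of 1 s]
    by (intro integral_curve_unique [OF X _ integral_curve_translate [OF X ic]]) (simp_all add: 0)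
  from fun_cong [OF this, of t] show "flow X (s + t) = gmul (flow X s) (flow X t)"
    by (simp add: add.commute)
qed

lemma ginv_flow:
  assumes X: "X \<in> lie_algebra gmul charts"
  shows "ginv (flow X t) = flow X (- t)"
  using flow_add [OF X, of "-t" t] flow_0 [OF X] by (metis add.left_inverse inverse_unique right_inverse left_inverse assoc group_left_neutral right_neutral)

lemma exp_L_scaleR: "exp_L (t *\<^sub>R w) = flow (L w) t"
  by (simp add: exp_L_def lie_exp_flow linear_scale [OF linear_L] flow_scaleR [OF L_in])

lemma exp_L_0: "exp_L 0 = e"
  using exp_L_scaleR [of 0 0] flow_0 [OF L_in] by simp

lemma flow_multiple_in:
  assumes X: "X \<in> lie_algebra gmul charts" and K: "e \<in> K" "\<And>g h. g \<in> K \<Longrightarrow> h \<in> K \<Longrightarrow> gmul g h \<in> K"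
    and "flow X t \<in> K"
  shows "flow X (real n * t) \<in> K"
  by (induction n) (simp_all add: flow_0 [OF X] K distrib_right flow_add [OF X] assms(4))

section \<open>Exponential and logarithm in a chart at the identity\<close>

lemma exp_L_differentiable:
  assumes "b \<in> charts" "e \<in> fst b"
  shows "(snd b \<circ> exp_L) differentiable at 0"
proof -
  define m :: "('e, 'e) chart" where "m = (UNIV, id)"
  have m: "m \<in> model_atlas" by (simp add: model_atlas_def m_def)
  have "smooth_on (snd m ` (exp_dom \<inter> fst m \<inter> exp_L -` fst b)) (snd b \<circ> exp_L \<circ> chart_inv m)"
    using smooth_exp_L [unfolded smooth_map_on_def, THEN conjunct2, THEN conjunct2, rule_format, OF m assms(1)] .
  then have "smooth_on (exp_dom \<inter> exp_L -` fst b) (snd b \<circ> exp_L)"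
    by (simp add: m_def chart_inv_def inv_id)
  from smooth_onD(1) [OF this, of 0] show ?thesis
    using zero_in_exp_dom assms(2) exp_L_0 by (auto intro: differentiableI)
qed

text \<open>The logarithm read in the chart \<open>b\<close>; near \<open>snd b e\<close> it inverts
  \<open>snd b \<circ> exp_L\<close>.\<close>

definition log_coord where "log_coord b = inv_into exp_dom exp_L \<circ> chart_inv b"

lemma
  assumes b: "b \<in> charts" "e \<in> fst b"
  shows open_log_domain: "open (snd b ` (exp_L ` exp_dom \<inter> fst b))"
    and log_coord_differentiable: "log_coord b differentiable at (snd b e)"
    and log_coord_e: "log_coord b (snd b e) = 0"
    and e_in_log_domain: "e \<in> exp_L ` exp_dom \<inter> fst b"
    and open_exp_image: "open (exp_L ` exp_dom)"
    and exp_L_log_coord: "p \<in> exp_L ` exp_dom \<inter> fst b \<Longrightarrow> exp_L (log_coord b (snd b p)) = p"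
proof -
  show open_image: "open (exp_L ` exp_dom)" using smooth_log unfolding smooth_map_on_def by blast
  show ee: "e \<in> exp_L ` exp_dom \<inter> fst b" using exp_L_0 zero_in_exp_dom b(2) by force
  show "open (snd b ` (exp_L ` exp_dom \<inter> fst b))"
    using homeomorphism_imp_open_map [OF chart_homeo [OF b(1)], of "exp_L ` exp_dom \<inter> fst b"]
    by (simp add: openin_open_eq [OF open_chart [OF b(1)]] openin_open_eq [OF open_chart_image [OF b(1)]]
        open_Int [OF open_image open_chart [OF b(1)]])
  define m :: "('e, 'e) chart" where "m = (UNIV, id)"
  have m: "m \<in> model_atlas" by (simp add: model_atlas_def m_def)
  have "smooth_on (snd b ` (exp_L ` exp_dom \<inter> fst b \<inter> inv_into exp_dom exp_L -` fst m)) (snd m \<circ> inv_into exp_dom exp_L \<circ> chart_inv b)"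
    using smooth_log [unfolded smooth_map_on_def, THEN conjunct2, THEN conjunct2, rule_format, OF b(1) m] .
  then have "smooth_on (snd b ` (exp_L ` exp_dom \<inter> fst b)) (log_coord b)"
    by (simp add: m_def log_coord_def)
  from smooth_onD(1) [OF this, of "snd b e"] show "log_coord b differentiable at (snd b e)"
    using ee by (auto intro: differentiableI)
  show "log_coord b (snd b e) = 0"
    using inv_into_f_f [OF inj_on_exp_L zero_in_exp_dom] by (simp add: log_coord_def cinv_chart b exp_L_0)
  show "exp_L (log_coord b (snd b p)) = p" if "p \<in> exp_L ` exp_dom \<inter> fst b"
    using that by (simp add: log_coord_def cinv_chart b f_inv_into_f)
qed

text \<open>On the line through \<open>w\<close> the exponential is the flow of \<open>L w\<close>,
  so its differential at 0 is evaluation of the field at \<open>e\<close>.\<close>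

lemma exp_L_derivative_0:
  assumes b: "b \<in> charts" "e \<in> fst b" and D: "((snd b \<circ> exp_L) has_derivative D) (at 0)"
  shows "D w = L w b e"
proof -
  have "((\<lambda>t. t *\<^sub>R w) has_derivative (\<lambda>t. t *\<^sub>R w)) (at (0::real))" by (auto intro!: derivative_eq_intros)
  from has_derivative_compose [where g = "snd b \<circ> exp_L", OF this] D
  have "((\<lambda>t. (snd b \<circ> exp_L) (t *\<^sub>R w)) has_derivative (\<lambda>t. D (t *\<^sub>R w))) (at 0)" by simp
  then have "((snd b \<circ> flow (L w)) has_vector_derivative D w) (at 0)"
    by (simp add: has_vector_derivative_def exp_L_scaleR o_def linear_scale [OF has_derivative_linear [OF D]])
  moreover have "((snd b \<circ> flow (L w)) has_vector_derivative L w b e) (at 0)"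
    using integral_curveD(3) [OF integral_curve_flow [OF L_in] b(1), of w 0] b(2) flow_0 [OF L_in] by simp
  ultimately show ?thesis by (rule vector_derivative_unique_at)
qed

text \<open>By the chain rule, the differential of the exponential undoes that of the logarithm. The
  former is evaluation at \<open>e\<close>, so both fields agree at \<open>e\<close> and hence
  everywhere.\<close>

lemma L_log_coord_derivative:
  assumes b: "b \<in> charts" "e \<in> fst b" and D: "(log_coord b has_derivative D) (at (snd b e))"
    and Z: "Z \<in> lie_algebra gmul charts"
  shows "L (D (Z b e)) = Z"
proof -
  obtain F where F: "((snd b \<circ> exp_L) has_derivative F) (at 0)"
    using exp_L_differentiable [OF b] unfolding differentiable_def by blast
  have "((\<lambda>a. (snd b \<circ> exp_L) (log_coord b a)) has_derivative (\<lambda>v. F (D v))) (at (snd b e))"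
    by (rule has_derivative_compose [OF D]) (simp only: log_coord_e [OF b] F)
  then have "((\<lambda>a. a) has_derivative (\<lambda>v. F (D v))) (at (snd b e))"
    by (rule has_derivative_transform_within_open [OF _ open_log_domain [OF b]])
       (use e_in_log_domain [OF b] exp_L_log_coord [OF b] in auto)
  then have "(\<lambda>v. F (D v)) = (\<lambda>v. v)" by (rule has_derivative_unique) (rule has_derivative_ident)
  then have "L (D (Z b e)) b e = Z b e" using exp_L_derivative_0 [OF b F] by metis
  then show ?thesis by (rule lie_algebra_eqI [OF L_in Z b])
qed

text \<open>With \<open>\<zeta>\<close> the logarithm of \<open>\<kappa>\<close>, the n-th power of
  \<open>\<kappa> (t / n)\<close> is the exponential of \<open>n\<close> times
  \<open>\<zeta> (t / n)\<close>, and these vectors tend to \<open>t *\<^sub>R w\<close> with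
  \<open>L w = Z\<close>. Only products and limits are formed, hence the semigroup setting and the
  restriction to \<open>0 \<le> t\<close>.\<close>

lemma tangent_to_closed_semigroup:
  assumes K: "closed K" "e \<in> K" "\<And>g h. g \<in> K \<Longrightarrow> h \<in> K \<Longrightarrow> gmul g h \<in> K"
    and b: "b \<in> charts" "e \<in> fst b"
    and Z: "Z \<in> lie_algebra gmul charts"
    and \<kappa>: "\<kappa> 0 = e" "\<And>s. 0 \<le> s \<Longrightarrow> \<kappa> s \<in> K" "(\<kappa> \<longlongrightarrow> e) (at_right 0)"
      "((snd b \<circ> \<kappa>) has_vector_derivative Z b e) (at 0 within {0..})"
    and t: "0 \<le> t"
  shows "flow Z t \<in> K"
proof -
  obtain D where D: "(log_coord b has_derivative D) (at (snd b e))"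
    using log_coord_differentiable [OF b] unfolding differentiable_def by blast
  define w where "w = D (Z b e)"
  have Lw: "L w = Z" unfolding w_def by (rule L_log_coord_derivative [OF b D Z])
  define \<zeta> where "\<zeta> s = log_coord b (snd b (\<kappa> s))" for s
  have "((\<lambda>s. log_coord b ((snd b \<circ> \<kappa>) s)) has_derivative (\<lambda>s. D (s *\<^sub>R Z b e))) (at 0 within {0..})"
    using \<kappa>(4) unfolding has_vector_derivative_def
    by (rule has_derivative_compose) (simp add: \<kappa>(1) D)
  then have "(\<zeta> has_vector_derivative w) (at 0 within {0..})"
    by (simp add: has_vector_derivative_def \<zeta>_def [abs_def] w_def linear_scale [OF has_derivative_linear [OF D]])
  moreover have "\<zeta> 0 = 0" by (simp add: \<zeta>_def \<kappa>(1) log_coord_e [OF b])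
  ultimately have lim: "((\<lambda>s. \<zeta> s /\<^sub>R s) \<longlongrightarrow> w) (at_right 0)"
    by (simp add: has_vector_derivative_right_iff)
  have "\<forall>\<^sub>F s in at_right 0. \<kappa> s \<in> exp_L ` exp_dom \<inter> fst b"
    by (intro topological_tendstoD [OF \<kappa>(3)] open_Int open_exp_image [OF b] open_chart b(1) e_in_log_domain [OF b])
  then have exp_\<zeta>: "\<forall>\<^sub>F s in at_right 0. exp_L (\<zeta> s) = \<kappa> s"
    by eventually_elim (simp add: \<zeta>_def exp_L_log_coord [OF b])
  have small: "flow Z t \<in> K" if "t > 0" "t *\<^sub>R w \<in> exp_dom" for t
  proof -
    have seq: "filterlim (\<lambda>n. t / real n) (at_right 0) sequentially"
      using that(1) by (auto simp: filterlim_at intro!: tendsto_divide_0 [OF tendsto_const] filterlim_at_top_imp_at_infinity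
          filterlim_real_sequentially eventually_mono [OF eventually_gt_at_top [of 0]])
    have "(\<lambda>n. t *\<^sub>R (\<zeta> (t / real n) /\<^sub>R (t / real n))) \<longlonglongrightarrow> t *\<^sub>R w"
      by (intro tendsto_scaleR tendsto_const filterlim_compose [OF lim seq])
    then have lim2: "(\<lambda>n. real n *\<^sub>R \<zeta> (t / real n)) \<longlonglongrightarrow> t *\<^sub>R w"
      using that(1) by simp
    have "isCont exp_L (t *\<^sub>R w)"
      using continuous_exp_L open_exp_dom that(2) continuous_on_eq_continuous_at by blast
    then have "(\<lambda>n. exp_L (real n *\<^sub>R \<zeta> (t / real n))) \<longlonglongrightarrow> exp_L (t *\<^sub>R w)"
      by (rule isCont_tendsto_compose [OF _ lim2])
    moreover have "\<forall>\<^sub>F n in sequentially. exp_L (real n *\<^sub>R \<zeta> (t / real n)) \<in> K"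
      using filterlim_iff [THEN iffD1, OF seq, rule_format, OF exp_\<zeta>]
    proof eventually_elim
      fix n assume "exp_L (\<zeta> (t / real n)) = \<kappa> (t / real n)"
      then have "flow (L (\<zeta> (t / real n))) 1 \<in> K"
        using exp_L_scaleR [of 1 "\<zeta> (t / real n)"] \<kappa>(2) [of "t / real n"] that(1) by simp
      then show "exp_L (real n *\<^sub>R \<zeta> (t / real n)) \<in> K"
        using flow_multiple_in [OF L_in K(2,3), of _ 1 n] by (simp add: exp_L_scaleR)
    qed
    ultimately have "exp_L (t *\<^sub>R w) \<in> K"
      by (intro Lim_in_closed_set [OF K(1)]) auto
    then show ?thesis by (simp add: exp_L_scaleR Lw)
  qed
  obtain \<delta> where \<delta>: "\<delta> > 0" "\<And>t. \<bar>t\<bar> < \<delta> \<Longrightarrow> t *\<^sub>R w \<in> exp_dom" using small_multiples_in_exp_dom by metis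
  show ?thesis
  proof (cases "t = 0")
    case True
    then show ?thesis by (simp add: flow_0 [OF Z] K(2))
  next
    case False
    \<comment> \<open>A general time is divided into \<open>n\<close> parts short enough for
      \<open>small\<close>, and the n-th power is taken in \<open>K\<close>.\<close>
    obtain n where n: "t / \<delta> < real n" using reals_Archimedean2 by blast
    moreover have "0 < t / \<delta>" using False t \<delta>(1) by simp
    ultimately have n0: "0 < real n" by linarith
    then have "t / real n < \<delta>" "0 < t / real n" using n False t \<delta>(1) by (simp_all add: field_simps)
    then have "flow Z (t / real n) \<in> K" by (intro small \<delta>(2)) auto
    from flow_multiple_in [OF Z K(2,3) this, of n] show ?thesis using n0 by simp
  qed
qed

end

section \<open>Asymptotics of commutators\<close>

lemma tendsto_zero_of_scaled:
  fixes f :: "real \<Rightarrow> 'f::real_normed_vector"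
  assumes "((\<lambda>s. f s /\<^sub>R s) \<longlongrightarrow> x) (at_right 0)"
  shows "(f \<longlongrightarrow> 0) (at_right 0)"
proof -
  have "((\<lambda>s. s *\<^sub>R (f s /\<^sub>R s)) \<longlongrightarrow> 0 *\<^sub>R x) (at_right 0)"
    by (intro tendsto_scaleR assms tendsto_ident_at)
  then have "((\<lambda>s. s *\<^sub>R (f s /\<^sub>R s)) \<longlongrightarrow> 0) (at_right 0)" by simp
  moreover have "\<forall>\<^sub>F s in at_right 0. s *\<^sub>R (f s /\<^sub>R s) = f s"
    using eventually_at_right_less [of 0] by eventually_elim simp
  ultimately show ?thesis by (rule Lim_transform_eventually)
qed

text \<open>Here \<open>a\<close>, \<open>b\<close>, \<open>p\<close>, \<open>q\<close>,
  \<open>z\<close> stand for the coordinates, relative to \<open>o'\<close>, of g, h, gh, hg and the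
  commutator c of g and h, which enters through c(hg) = gh, so that no inverse is expanded. As
  \<open>p - q\<close> is the antisymmetrised bilinear term up to o(s^2), it remains to compare
  \<open>z\<close> with \<open>p - q\<close> to that order.\<close>

lemma commutator_asymptotics:
  fixes M :: "'e::real_normed_vector \<times> 'e \<Rightarrow> 'e" and B :: "'e set"
  assumes bas: "coord_basis B C" and U: "open U" "(o', o') \<in> U" and M: "smooth_on U M"
    and unit: "\<forall>\<^sub>F v in nhds 0. M (o' + v, o') = o' + v \<and> M (o', o' + v) = o' + v"
    and a: "((\<lambda>s. a s /\<^sub>R s) \<longlongrightarrow> x) (at_right 0)" and b: "((\<lambda>s. b s /\<^sub>R s) \<longlongrightarrow> y) (at_right 0)"
    and z: "(z \<longlongrightarrow> 0) (at_right 0)" and q: "(q \<longlongrightarrow> 0) (at_right 0)"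
    and ab: "\<forall>\<^sub>F s in at_right 0. M (o' + a s, o' + b s) = o' + p s"
    and ba: "\<forall>\<^sub>F s in at_right 0. M (o' + b s, o' + a s) = o' + q s"
    and zq: "\<forall>\<^sub>F s in at_right 0. M (o' + z s, o' + q s) = o' + p s"
  shows "((\<lambda>s. z s /\<^sub>R s\<^sup>2) \<longlongrightarrow> mixed_deriv M (o', o') x y - mixed_deriv M (o', o') y x) (at_right 0)"
proof -
  define D where "D = mixed_deriv M (o', o')"
  have linD: "linear (\<lambda>a. D a b)" "linear (D a)" for a b
    unfolding D_def by (rule linear_mixed_deriv [OF U M])+
  interpret D: bounded_bilinear D by (rule coord_basis_bounded_bilinear [OF bas linD])
  \<comment> \<open>The remainder after the linear and bilinear terms; near 0 it is, by the unit
    laws, the second difference of \<open>M\<close> minus \<open>D u v\<close>.\<close>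
  define R where "R u v = M (o' + u, o' + v) - o' - u - v - D u v" for u v
  have M0: "M (o', o') = o'" using eventually_nhds_x_imp_x [OF unit] by simp
  have R: "\<forall>\<^sub>F s in at_right 0. norm (R (f s) (g s)) \<le> \<epsilon> * norm (f s) * norm (g s)"
    if f: "(f \<longlongrightarrow> 0) (at_right 0)" and g: "(g \<longlongrightarrow> 0) (at_right 0)" and \<epsilon>: "\<epsilon> > 0" for f g :: "real \<Rightarrow> 'e" and \<epsilon>
  proof -
    obtain d where d: "d > 0" "\<And>a b. norm a < d \<Longrightarrow> norm b < d \<Longrightarrow>
      norm (M (o' + a, o' + b) - M (o' + a, o') - M (o', o' + b) + M (o', o') - D a b) \<le> \<epsilon> * norm a * norm b"
      by (rule mixed_second_difference [OF bas U M \<epsilon>, folded D_def]) (rule that)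
    have "\<forall>\<^sub>F s in at_right 0. norm (f s) < d" "\<forall>\<^sub>F s in at_right 0. norm (g s) < d"
      using f g d(1) by (auto simp: tendsto_iff)
    moreover have "\<forall>\<^sub>F s in at_right 0. M (o' + f s, o') = o' + f s"
      using eventually_compose_filterlim [OF unit f] by eventually_elim simp
    moreover have "\<forall>\<^sub>F s in at_right 0. M (o', o' + g s) = o' + g s"
      using eventually_compose_filterlim [OF unit g] by eventually_elim simp
    ultimately show ?thesis
    proof eventually_elim
      case (elim s)
      show ?case using d(2) [OF elim(1,2)] elim(3,4) M0 by (simp add: R_def algebra_simps)
    qed
  qed
  have rem: "((\<lambda>s. R (f s) (g s) /\<^sub>R s\<^sup>2) \<longlongrightarrow> 0) (at_right 0)"
    if f: "((\<lambda>s. f s /\<^sub>R s) \<longlongrightarrow> u) (at_right 0)" and g: "((\<lambda>s. g s /\<^sub>R s) \<longlongrightarrow> v) (at_right 0)"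
    for f g :: "real \<Rightarrow> 'e" and u v
  proof (rule tendstoI)
    fix \<epsilon> :: real assume \<epsilon>: "\<epsilon> > 0"
    \<comment> \<open>Strictly above the limit of the product of the scaled norms, and positive even
      if that limit is 0.\<close>
    define c where "c = norm u * norm v + 1"
    have c: "c > 0" unfolding c_def by (simp add: add_nonneg_pos)
    have "((\<lambda>s. norm (f s /\<^sub>R s) * norm (g s /\<^sub>R s)) \<longlongrightarrow> norm u * norm v) (at_right 0)"
      by (intro tendsto_intros f g)
    then have "\<forall>\<^sub>F s in at_right 0. norm (f s /\<^sub>R s) * norm (g s /\<^sub>R s) < c"
      by (rule order_tendstoD) (simp add: c_def)
    moreover have "\<forall>\<^sub>F s in at_right 0. norm (R (f s) (g s)) \<le> (\<epsilon> / c) * norm (f s) * norm (g s)"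
      using \<epsilon> c by (intro R tendsto_zero_of_scaled [OF f] tendsto_zero_of_scaled [OF g]) simp
    ultimately show "\<forall>\<^sub>F s in at_right 0. dist (R (f s) (g s) /\<^sub>R s\<^sup>2) 0 < \<epsilon>"
      using eventually_at_right_less [of 0]
    proof eventually_elim
      case (elim s)
      have "norm (R (f s) (g s) /\<^sub>R s\<^sup>2) = norm (R (f s) (g s)) / s\<^sup>2" by (simp add: divide_inverse mult.commute)
      also have "\<dots> \<le> ((\<epsilon> / c) * norm (f s) * norm (g s)) / s\<^sup>2"
        by (intro divide_right_mono elim(2)) simp
      also have "\<dots> = (\<epsilon> / c) * (norm (f s /\<^sub>R s) * norm (g s /\<^sub>R s))"
        using elim(3) by (simp add: divide_inverse power2_eq_square mult_ac)
      also have "\<dots> < (\<epsilon> / c) * c" using elim(1) \<epsilon> c by (intro mult_strict_left_mono) auto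
      finally show ?case using c by simp
    qed
  qed
  have a0: "(a \<longlongrightarrow> 0) (at_right 0)" and b0: "(b \<longlongrightarrow> 0) (at_right 0)"
    by (rule tendsto_zero_of_scaled [OF a] tendsto_zero_of_scaled [OF b])+
  \<comment> \<open>The linear terms of \<open>p\<close> and \<open>q\<close> coincide and cancel in
    the difference.\<close>
  have pq: "((\<lambda>s. (p s - q s) /\<^sub>R s\<^sup>2) \<longlongrightarrow> D x y - D y x) (at_right 0)"
  proof -
    have "((\<lambda>s. (D (a s /\<^sub>R s) (b s /\<^sub>R s) - D (b s /\<^sub>R s) (a s /\<^sub>R s)) + (R (a s) (b s) /\<^sub>R s\<^sup>2 - R (b s) (a s) /\<^sub>R s\<^sup>2))
        \<longlongrightarrow> (D x y - D y x) + (0 - 0)) (at_right 0)"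
      by (intro tendsto_intros D.tendsto rem [OF a b] rem [OF b a] a b)
    moreover have "\<forall>\<^sub>F s in at_right 0. (D (a s /\<^sub>R s) (b s /\<^sub>R s) - D (b s /\<^sub>R s) (a s /\<^sub>R s)) + (R (a s) (b s) /\<^sub>R s\<^sup>2 - R (b s) (a s) /\<^sub>R s\<^sup>2)
        = (p s - q s) /\<^sub>R s\<^sup>2"
      using ab ba
    proof eventually_elim
      case (elim s)
      have "D (u /\<^sub>R s) (v /\<^sub>R s) = D u v /\<^sub>R s\<^sup>2" for u v
        by (simp add: D.scaleR_left D.scaleR_right power2_eq_square)
      moreover have "p s - q s = (D (a s) (b s) - D (b s) (a s)) + (R (a s) (b s) - R (b s) (a s))"
        using elim by (simp add: R_def)
      ultimately show ?case by (simp add: scaleR_diff_right scaleR_add_right)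
    qed
    ultimately show ?thesis using Lim_transform_eventually by fastforce
  qed
  obtain K where K: "K > 0" "\<And>u v. norm (D u v) \<le> norm u * norm v * K" using D.pos_bounded by blast
  define c where "c = K + 1"
  have c: "c > 0" using K(1) by (simp add: c_def)
  \<comment> \<open>From c(hg) = gh: the error is a multiple of \<open>norm (z s)\<close> whose
    factor tends to 0 because \<open>q\<close> does.\<close>
  have zpq: "\<forall>\<^sub>F s in at_right 0. norm (z s - (p s - q s)) \<le> c * norm (q s) * norm (z s)"
    using R [OF z q zero_less_one] zq
  proof eventually_elim
    case (elim s)
    have "z s - (p s - q s) = - (D (z s) (q s) + R (z s) (q s))" using elim(2) by (simp add: R_def)
    then have "norm (z s - (p s - q s)) \<le> norm (D (z s) (q s)) + norm (R (z s) (q s))"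
      by (metis norm_minus_cancel norm_triangle_ineq)
    also have "\<dots> \<le> norm (z s) * norm (q s) * K + 1 * norm (z s) * norm (q s)"
      by (intro add_mono K(2) elim(1))
    finally show ?case by (simp add: c_def algebra_simps)
  qed
  have "((\<lambda>s. c * norm (q s)) \<longlongrightarrow> c * norm (0::'e)) (at_right 0)" by (intro tendsto_intros q)
  \<comment> \<open>A factor below 1/2 lets \<open>z\<close> be absorbed: \<open>norm (z s)\<close>
    is at most twice \<open>norm (p s - q s)\<close>, so the error is of smaller order than
    s^2.\<close>
  then have "\<forall>\<^sub>F s in at_right 0. c * norm (q s) < 1 / 2" by (rule order_tendstoD) simp
  with zpq have err: "\<forall>\<^sub>F s in at_right 0. norm ((z s - (p s - q s)) /\<^sub>R s\<^sup>2) \<le> c * norm (q s) * (2 * norm ((p s - q s) /\<^sub>R s\<^sup>2))"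
  proof eventually_elim
    case (elim s)
    have "norm (z s) \<le> norm (z s - (p s - q s)) + norm (p s - q s)"
      using norm_triangle_ineq [of "z s - (p s - q s)" "p s - q s"] by simp
    also have "norm (z s - (p s - q s)) \<le> 1 / 2 * norm (z s)"
      using elim(1) mult_right_mono [OF less_imp_le [OF elim(2)], of "norm (z s)"] by simp
    finally have "norm (z s) \<le> 2 * norm (p s - q s)" by simp
    then have "norm (z s - (p s - q s)) \<le> c * norm (q s) * (2 * norm (p s - q s))"
      using elim(1) c by (elim order_trans) (intro mult_left_mono, auto)
    from mult_left_mono [OF this, of "inverse (s\<^sup>2)"] show ?case by (simp add: mult_ac)
  qed
  have "((\<lambda>s. c * norm (q s) * (2 * norm ((p s - q s) /\<^sub>R s\<^sup>2))) \<longlongrightarrow> c * norm (0::'e) * (2 * norm (D x y - D y x))) (at_right 0)"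
    by (intro tendsto_intros q pq)
  then have "((\<lambda>s. (z s - (p s - q s)) /\<^sub>R s\<^sup>2) \<longlongrightarrow> 0) (at_right 0)"
    by (intro Lim_null_comparison [OF err]) simp
  from tendsto_add [OF this pq] show ?thesis unfolding D_def by (simp add: algebra_simps)
qed

context lie_group_exp
begin

lemma flow_in_chart:
  assumes "X \<in> lie_algebra gmul charts" "b \<in> charts" "e \<in> fst b"
  shows "\<forall>\<^sub>F s in nhds 0. flow X s \<in> fst b"
    and "((snd b \<circ> flow X) has_vector_derivative X b e) (at 0)"
    and "(flow X \<longlongrightarrow> e) (at_right 0)"
  using integral_curveD(4) [OF integral_curve_flow [OF assms(1)] assms(2), of 0]
    integral_curveD(3) [OF integral_curve_flow [OF assms(1)] assms(2), of 0] flow_0 [OF assms(1)] assms(3)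
    tendsto_mono [OF _ integral_curveD(1) [OF integral_curve_flow [OF assms(1)], of 0], of "at_right 0"]
  by (simp_all add: at_within_le_nhds)

section \<open>The multiplication in one chart at the identity\<close>

context
  fixes b and o' :: 'e and M
  assumes b: "b \<in> charts" "e \<in> fst b"
  defines "o' \<equiv> snd b e" and "M \<equiv> mul_coord b b b"
begin

lemma M_dom: "(o', o') \<in> mul_dom b b b"
  using b by (simp add: mul_dom_def o'_def cinv_chart group_left_neutral)

lemma M_smooth: "smooth_on (mul_dom b b b) M"
  unfolding M_def by (rule smooth_mul_coord [OF b(1) b(1) b(1)])

lemma M_open: "open (mul_dom b b b)"
  by (rule open_mul_dom [OF b(1) b(1) b(1)])

lemma M_chart: "g \<in> fst b \<Longrightarrow> h \<in> fst b \<Longrightarrow> M (snd b g, snd b h) = snd b (gmul g h)"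
  by (simp add: M_def mul_coord_def cinv_chart b)

lemma M_unit:
  assumes "v \<in> snd b ` fst b"
  shows "M (v, o') = v" "M (o', v) = v"
  using assms M_chart b by (auto simp: o'_def group_left_neutral)

lemma M_unit_near: "\<forall>\<^sub>F v in nhds 0. M (o' + v, o') = o' + v \<and> M (o', o' + v) = o' + v"
proof -
  have "((\<lambda>v. o' + v) \<longlongrightarrow> o' + 0) (nhds 0)" by (intro tendsto_intros) (rule filterlim_ident)
  then have "\<forall>\<^sub>F v in nhds 0. o' + v \<in> snd b ` fst b"
    using open_chart_image [OF b(1)] b(2) by (intro topological_tendstoD) (auto simp: o'_def)
  then show ?thesis by eventually_elim (simp add: M_unit)
qed

text \<open>The unit laws make both partial derivatives the identity, and a linear map on a product
  is the sum of its restrictions to the factors.\<close>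

lemma M_derivative: "(M has_derivative (\<lambda>(u, v). u + v)) (at (o', o'))"
proof -
  define D where "D = frechet_derivative M (at (o', o'))"
  have D: "(M has_derivative D) (at (o', o'))" unfolding D_def by (rule smooth_onD(1) [OF M_smooth M_dom])
  have o': "o' \<in> snd b ` fst b" using b by (simp add: o'_def)
  have "((\<lambda>a. M (a, o')) has_derivative (\<lambda>u. D (u, 0))) (at o')"
    by (rule has_derivative_compose [where g = M]) (auto intro!: derivative_eq_intros D)
  then have "((\<lambda>a. a) has_derivative (\<lambda>u. D (u, 0))) (at o')"
    by (rule has_derivative_transform_within_open [OF _ open_chart_image [OF b(1)] o']) (rule M_unit)
  then have 1: "(\<lambda>u. D (u, 0)) = (\<lambda>u. u)" by (rule has_derivative_unique) (rule has_derivative_ident)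
  have "((\<lambda>a. M (o', a)) has_derivative (\<lambda>u. D (0, u))) (at o')"
    by (rule has_derivative_compose [where g = M]) (auto intro!: derivative_eq_intros D)
  then have "((\<lambda>a. a) has_derivative (\<lambda>u. D (0, u))) (at o')"
    by (rule has_derivative_transform_within_open [OF _ open_chart_image [OF b(1)] o']) (rule M_unit)
  then have 2: "(\<lambda>u. D (0, u)) = (\<lambda>u. u)" by (rule has_derivative_unique) (rule has_derivative_ident)
  have "D (u, v) = u + v" for u v
    using linear_add [OF has_derivative_linear [OF D], of "(u, 0)" "(0, v)"] fun_cong [OF 1, of u] fun_cong [OF 2, of v] by simp
  then have "D = (\<lambda>(u, v). u + v)" by auto
  with D show ?thesis by simp
qed

text \<open>By left invariance the field at g is the second-slot partial derivative of
  \<open>M\<close> at the coordinates of g and \<open>e\<close>, taken along \<open>X b e\<close>;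
  differentiating it in g gives the mixed derivative.\<close>

lemma field_derivative_eq_mixed_deriv:
  assumes X: "X \<in> lie_algebra gmul charts"
  shows "frechet_derivative (X b \<circ> cinv b) (at o') v = mixed_deriv M (o', o') v (X b e)"
proof -
  define D where "D q = frechet_derivative M (at q) (0, X b e)" for q
  have D: "(D has_derivative frechet_derivative D (at (o', o'))) (at (o', o'))"
    unfolding D_def by (rule smooth_onD(1) [OF smooth_onD(2) [OF M_smooth] M_dom])
  have 1: "((\<lambda>a. D (a, o')) has_derivative (\<lambda>v. frechet_derivative D (at (o', o')) (v, 0))) (at o')"
    by (rule has_derivative_compose [where g = D]) (auto intro!: derivative_eq_intros D)
  have 2: "D (a, o') = (X b \<circ> cinv b) a" if a: "a \<in> snd b ` fst b" for a
  proof -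
    obtain g where g: "g \<in> fst b" "a = snd b g" using a by blast
    have ge: "gmul g e \<in> fst b" using g by simp
    have "frechet_derivative (snd b \<circ> gmul g \<circ> cinv b) (at (snd b e)) = (\<lambda>w. frechet_derivative M (at (snd b g, snd b e)) (0, w))"
      using frechet_derivative_at [OF left_translation_has_derivative [OF b(1) b(1) b(2) ge b(1) g(1)]] by (simp add: M_def)
    then show ?thesis
      using lie_algebra_translate [OF X b(1) b(1) b(2) ge] g by (simp add: D_def o'_def cinv_chart b)
  qed
  have "o' \<in> snd b ` fst b" using b by (simp add: o'_def)
  then have "((X b \<circ> cinv b) has_derivative (\<lambda>v. frechet_derivative D (at (o', o')) (v, 0))) (at o')"
    by (rule has_derivative_transform_within_open [OF 1 open_chart_image [OF b(1)] _ 2])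
  from frechet_derivative_at [OF this] show ?thesis unfolding mixed_deriv_def D_def [symmetric] by metis
qed

lemma lie_bracket_eq_mixed_deriv:
  assumes "X \<in> lie_algebra gmul charts" "Y \<in> lie_algebra gmul charts"
  shows "lie_bracket charts X Y b e = mixed_deriv M (o', o') (X b e) (Y b e) - mixed_deriv M (o', o') (Y b e) (X b e)"
  using field_derivative_eq_mixed_deriv [OF assms(1)] field_derivative_eq_mixed_deriv [OF assms(2)]
  unfolding lie_bracket_def o'_def by (simp add: b)

lemma product_curve_derivative:
  assumes X: "X \<in> lie_algebra gmul charts" and Y: "Y \<in> lie_algebra gmul charts"
  shows "((snd b \<circ> (\<lambda>s. gmul (flow X s) (flow Y s))) has_vector_derivative (X + Y) b e) (at 0)"
proof -
  note dX = flow_in_chart(2) [OF X b] and dY = flow_in_chart(2) [OF Y b]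
  have "((\<lambda>s. M ((snd b \<circ> flow X) s, (snd b \<circ> flow Y) s)) has_derivative
      (\<lambda>s. (\<lambda>(u, v). u + v) (s *\<^sub>R X b e, s *\<^sub>R Y b e))) (at 0)"
    by (rule has_derivative_compose [where g = M, OF has_derivative_Pair [OF dX [unfolded has_vector_derivative_def] dY [unfolded has_vector_derivative_def]]])
       (simp add: flow_0 X Y M_derivative o'_def [symmetric])
  then have "((\<lambda>s. M ((snd b \<circ> flow X) s, (snd b \<circ> flow Y) s)) has_vector_derivative (X + Y) b e) (at 0)"
    by (simp add: has_vector_derivative_def scaleR_add_right)
  moreover have "\<forall>\<^sub>F s in nhds 0. M ((snd b \<circ> flow X) s, (snd b \<circ> flow Y) s) = (snd b \<circ> (\<lambda>s. gmul (flow X s) (flow Y s))) s"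
    using flow_in_chart(1) [OF X b] flow_in_chart(1) [OF Y b] by eventually_elim (simp add: M_chart)
  ultimately show ?thesis by (rule has_vector_derivative_cong_nhds)
qed

text \<open>The commutator of the two flows at time s deviates from \<open>e\<close> to order s^2,
  so inserting a square root turns its leading term into a one-sided tangent vector.\<close>

lemma commutator_curve_derivative:
  assumes X: "X \<in> lie_algebra gmul charts" and Y: "Y \<in> lie_algebra gmul charts"
  defines "c \<equiv> \<lambda>s. gmul (gmul (flow X s) (flow Y s)) (ginv (gmul (flow Y s) (flow X s)))"
  shows "((snd b \<circ> (\<lambda>r. c (sqrt r))) has_vector_derivative lie_bracket charts X Y b e) (at 0 within {0..})"
    and "((\<lambda>r. c (sqrt r)) \<longlongrightarrow> e) (at_right 0)"
proof -
  have sqrt: "filterlim sqrt (at_right 0) (at_right (0::real))"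
    using eventually_at_right_less [of "0::real"]
    by (auto simp: filterlim_at intro!: tendsto_eq_intros elim!: eventually_mono)
  note lX = flow_in_chart(3) [OF X b] and lY = flow_in_chart(3) [OF Y b]
  have lXY: "((\<lambda>s. gmul (flow X s) (flow Y s)) \<longlongrightarrow> e) (at_right 0)"
    using tendsto_gmul [OF lX lY] by simp
  have lYX: "((\<lambda>s. gmul (flow Y s) (flow X s)) \<longlongrightarrow> e) (at_right 0)"
    using tendsto_gmul [OF lY lX] by simp
  have lc: "(c \<longlongrightarrow> e) (at_right 0)"
    using tendsto_gmul [OF lXY tendsto_ginv [OF lYX]] unfolding c_def by simp
  then show "((\<lambda>r. c (sqrt r)) \<longlongrightarrow> e) (at_right 0)" by (rule filterlim_compose [OF _ sqrt])
  define z where "z s = snd b (c s) - o'" for s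
  define q where "q s = snd b (gmul (flow Y s) (flow X s)) - o'" for s
  define p where "p s = snd b (gmul (flow X s) (flow Y s)) - o'" for s
  define u where "u s = snd b (flow X s) - o'" for s
  define w where "w s = snd b (flow Y s) - o'" for s
  have zero: "((\<lambda>s. snd b (f s) - o') \<longlongrightarrow> 0) (at_right 0)" if "(f \<longlongrightarrow> e) (at_right 0)" for f :: "real \<Rightarrow> 'g"
    using chart_tendsto(1) [OF b that] unfolding o'_def by (rule LIM_zero)
  have scaled: "((\<lambda>s. (snd b (flow Z s) - o') /\<^sub>R s) \<longlongrightarrow> Z b e) (at_right 0)" if Z: "Z \<in> lie_algebra gmul charts" for Z
    using has_vector_derivative_at_within [OF flow_in_chart(2) [OF Z b], of "{0..}"]
    by (simp add: has_vector_derivative_right_iff flow_0 [OF Z] o'_def)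
  note near = chart_tendsto(2) [OF b]
  obtain B :: "'e set" and C where bas: "coord_basis B C" using basis_exists .
  have "((\<lambda>s. z s /\<^sub>R s\<^sup>2) \<longlongrightarrow> mixed_deriv M (o', o') (X b e) (Y b e) - mixed_deriv M (o', o') (Y b e) (X b e)) (at_right 0)"
  proof (rule commutator_asymptotics [OF bas M_open M_dom M_smooth M_unit_near, where a = u and b = w and p = p and q = q])
    show "((\<lambda>s. u s /\<^sub>R s) \<longlongrightarrow> X b e) (at_right 0)" "((\<lambda>s. w s /\<^sub>R s) \<longlongrightarrow> Y b e) (at_right 0)"
      unfolding u_def w_def by (intro scaled X Y)+
    show "(z \<longlongrightarrow> 0) (at_right 0)" "(q \<longlongrightarrow> 0) (at_right 0)"
      unfolding z_def [abs_def] q_def [abs_def] by (intro zero lc lYX)+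
    show "\<forall>\<^sub>F s in at_right 0. M (o' + u s, o' + w s) = o' + p s"
      using near [OF lX] near [OF lY] by eventually_elim (simp add: u_def w_def p_def M_chart)
    show "\<forall>\<^sub>F s in at_right 0. M (o' + w s, o' + u s) = o' + q s"
      using near [OF lX] near [OF lY] by eventually_elim (simp add: u_def w_def q_def M_chart)
    have cs: "gmul (c s) (gmul (flow Y s) (flow X s)) = gmul (flow X s) (flow Y s)" for s
      unfolding c_def by (simp add: assoc)
    show "\<forall>\<^sub>F s in at_right 0. M (o' + z s, o' + q s) = o' + p s"
      using near [OF lc] near [OF lYX] by eventually_elim (simp add: z_def q_def p_def M_chart cs)
  qed
  then have "((\<lambda>r. z (sqrt r) /\<^sub>R (sqrt r)\<^sup>2) \<longlongrightarrow> lie_bracket charts X Y b e) (at_right 0)"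
    unfolding lie_bracket_eq_mixed_deriv [OF X Y] by (rule filterlim_compose [OF _ sqrt])
  \<comment> \<open>The square of \<open>sqrt r\<close> is \<open>r\<close> for positive
    \<open>r\<close>, and \<open>c 0\<close> is \<open>e\<close>, so these are the difference
    quotients at 0.\<close>
  moreover have "\<forall>\<^sub>F r in at_right (0::real). z (sqrt r) /\<^sub>R (sqrt r)\<^sup>2
      = ((snd b \<circ> (\<lambda>r. c (sqrt r))) r - (snd b \<circ> (\<lambda>r. c (sqrt r))) 0) /\<^sub>R r"
    using eventually_at_right_less [of 0]
    by eventually_elim (simp add: z_def c_def flow_0 [OF X] flow_0 [OF Y] o'_def)
  ultimately show "((snd b \<circ> (\<lambda>r. c (sqrt r))) has_vector_derivative lie_bracket charts X Y b e) (at 0 within {0..})"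
    unfolding has_vector_derivative_right_iff by (rule Lim_transform_eventually)
qed

end

end

section \<open>Closed subgroups and their tangent algebras\<close>

locale closed_subgroup = lie_group_exp +
  fixes K :: "'a set"
  assumes closed_K: "closed K"
    and e_in_K: "e \<in> K"
    and gmul_in_K: "g \<in> K \<Longrightarrow> h \<in> K \<Longrightarrow> gmul g h \<in> K"
    and ginv_in_K: "g \<in> K \<Longrightarrow> ginv g \<in> K"
begin

text \<open>The Lie algebra of \<open>K\<close>, described by one-parameter subgroups instead of a
  manifold structure on \<open>K\<close>.\<close>

definition tangent_algebra :: "('a, 'b) field set" where
  "tangent_algebra = {X \<in> lie_algebra gmul charts. \<forall>t. flow X t \<in> K}"

text \<open>Nonnegative times come from \<open>tangent_to_closed_semigroup\<close>, negative ones by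
  inversion in \<open>K\<close>.\<close>

lemma tangent_algebraI:
  assumes Z: "Z \<in> lie_algebra gmul charts" and b: "b \<in> charts" "e \<in> fst b"
    and \<kappa>: "\<kappa> 0 = e" "\<And>s. 0 \<le> s \<Longrightarrow> \<kappa> s \<in> K" "(\<kappa> \<longlongrightarrow> e) (at_right 0)"
      "((snd b \<circ> \<kappa>) has_vector_derivative Z b e) (at 0 within {0..})"
  shows "Z \<in> tangent_algebra"
proof -
  have pos: "flow Z t \<in> K" if "t \<ge> 0" for t
    by (rule tangent_to_closed_semigroup [OF closed_K e_in_K gmul_in_K b Z \<kappa> that])
  have "flow Z t \<in> K" for t
  proof (cases "t \<ge> 0")
    case False
    then have "ginv (flow Z (- t)) \<in> K" by (intro ginv_in_K pos) simp
    then show ?thesis by (simp add: ginv_flow [OF Z])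
  qed (rule pos)
  then show ?thesis using Z by (simp add: tangent_algebra_def)
qed

lemma subspace_tangent_algebra: "subspace tangent_algebra"
proof (rule subspaceI)
  show "0 \<in> tangent_algebra"
    using subspace_0 [OF subspace_lie_algebra] flow_scaleR [of 0 0] flow_0 [of 0] e_in_K
    by (simp add: tangent_algebra_def)
  show "c *\<^sub>R X \<in> tangent_algebra" if "X \<in> tangent_algebra" for c X
    using that subspace_scale [OF subspace_lie_algebra] flow_scaleR
    by (simp add: tangent_algebra_def)
  fix X Y assume "X \<in> tangent_algebra" "Y \<in> tangent_algebra"
  then have X: "X \<in> lie_algebra gmul charts" "\<And>t. flow X t \<in> K" and Y: "Y \<in> lie_algebra gmul charts" "\<And>t. flow Y t \<in> K"
    by (simp_all add: tangent_algebra_def)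
  obtain b where b: "b \<in> charts" "e \<in> fst b" using chart_at .
  show "X + Y \<in> tangent_algebra"
  proof (rule tangent_algebraI [OF _ b, where \<kappa> = "\<lambda>s. gmul (flow X s) (flow Y s)"])
    show "X + Y \<in> lie_algebra gmul charts" by (rule subspace_add [OF subspace_lie_algebra X(1) Y(1)])
    show "((\<lambda>s. gmul (flow X s) (flow Y s)) \<longlongrightarrow> e) (at_right 0)"
      using tendsto_gmul [OF flow_in_chart(3) [OF X(1) b] flow_in_chart(3) [OF Y(1) b]] by simp
    show "((snd b \<circ> (\<lambda>s. gmul (flow X s) (flow Y s))) has_vector_derivative (X + Y) b e) (at 0 within {0..})"
      by (rule has_vector_derivative_at_within [OF product_curve_derivative [OF b X(1) Y(1)]])
  qed (simp_all add: flow_0 X Y gmul_in_K)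
qed

text \<open>The commutator curve stays in \<open>K\<close> and has the bracket as its tangent. That
  the bracket is again in the Lie algebra is a hypothesis at this stage; it is later derived from
  the generation assumption.\<close>

lemma bracket_in_tangent_algebra:
  assumes "X \<in> tangent_algebra" "Y \<in> tangent_algebra" and XY: "lie_bracket charts X Y \<in> lie_algebra gmul charts"
  shows "lie_bracket charts X Y \<in> tangent_algebra"
proof -
  have X: "X \<in> lie_algebra gmul charts" "\<And>t. flow X t \<in> K" and Y: "Y \<in> lie_algebra gmul charts" "\<And>t. flow Y t \<in> K"
    using assms(1,2) by (simp_all add: tangent_algebra_def)
  obtain b where b: "b \<in> charts" "e \<in> fst b" using chart_at .
  show ?thesis
    by (rule tangent_algebraI [OF XY b _ _ commutator_curve_derivative(2,1) [OF b X(1) Y(1)]])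
       (simp_all add: flow_0 X Y gmul_in_K ginv_in_K)
qed

text \<open>\<open>K\<close> contains the image of \<open>exp_dom\<close>, an open neighbourhood of
  \<open>e\<close>; its translates make \<open>K\<close> open, and a nonempty clopen subset of a
  connected space is everything.\<close>

lemma UNIV_if_tangent_algebra_full:
  assumes "connected (UNIV :: 'a set)" and full: "lie_algebra gmul charts \<subseteq> tangent_algebra"
  shows "K = UNIV"
proof -
  obtain b where b: "b \<in> charts" "e \<in> fst b" using chart_at .
  have image_subset: "exp_L ` exp_dom \<subseteq> K"
    using full L_in exp_L_scaleR [of 1] unfolding tangent_algebra_def by auto
  have "open K"
  proof (rule openI_nhds)
    fix g assume g: "g \<in> K"
    have "((\<lambda>h. gmul (ginv g) h) \<longlongrightarrow> gmul (ginv g) g) (nhds g)"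
      by (intro tendsto_gmul tendsto_const filterlim_ident)
    then have "\<forall>\<^sub>F h in nhds g. gmul (ginv g) h \<in> exp_L ` exp_dom"
      using open_exp_image [OF b] e_in_log_domain [OF b] by (intro topological_tendstoD) auto
    then show "\<forall>\<^sub>F h in nhds g. h \<in> K"
    proof eventually_elim
      case (elim h)
      then have "gmul g (gmul (ginv g) h) \<in> K" using image_subset g gmul_in_K by blast
      then show ?case by (simp add: assoc [symmetric])
    qed
  qed
  then have "K = {} \<or> K = UNIV"
    using assms(1) closed_K unfolding connected_clopen by simp
  then show ?thesis using e_in_K by blast
qed

end

text \<open>If no Lie subalgebra contained \<open>V\<close>, the generated algebra would be an
  intersection over the empty family, hence \<open>UNIV\<close>. So there is such a subalgebra; it
  contains the generated algebra and, by definition, lies in \<open>lie_algebra gmul charts\<close>,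
  so the two coincide.\<close>

lemma lie_bracket_closed_if_generated:
  assumes gen: "lie_algebra_generated gmul charts V = lie_algebra gmul charts"
    and ne: "lie_algebra gmul charts \<noteq> UNIV"
  shows "lie_subalgebra gmul charts (lie_algebra gmul charts)"
proof -
  have "\<exists>W. lie_subalgebra gmul charts W \<and> V \<subseteq> W"
  proof (rule ccontr)
    assume "\<nexists>W. lie_subalgebra gmul charts W \<and> V \<subseteq> W"
    then have "lie_algebra_generated gmul charts V = UNIV" unfolding lie_algebra_generated_def by auto
    then show False using gen ne by simp
  qed
  then obtain W where W: "lie_subalgebra gmul charts W" "V \<subseteq> W" by blast
  then have "lie_algebra gmul charts \<subseteq> W"
    unfolding gen [symmetric] lie_algebra_generated_def by blast
  moreover have "W \<subseteq> lie_algebra gmul charts" using W(1) by (simp add: lie_subalgebra_def)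
  ultimately show ?thesis using W(1) by auto
qed

lemma lie_bracket_in_lie_algebra:
  assumes gen: "lie_algebra_generated gmul charts V = lie_algebra gmul charts"
    and "X \<in> lie_algebra gmul charts" "Y \<in> lie_algebra gmul charts"
  shows "lie_bracket charts X Y \<in> lie_algebra gmul charts"
proof (cases "lie_algebra gmul charts = UNIV")
  case False
  from lie_bracket_closed_if_generated [OF gen this] show ?thesis
    using assms(2,3) unfolding lie_subalgebra_def by blast
qed simp

context closed_subgroup
begin

text \<open>\<open>tangent_algebra\<close> is one of the Lie subalgebras whose intersection is the
  generated algebra, so it is the full Lie algebra.\<close>

lemma UNIV_if_generating:
  assumes conn: "connected (UNIV :: 'a set)" and gen: "lie_algebra_generated gmul charts V = lie_algebra gmul charts"
    and V: "V \<subseteq> tangent_algebra"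
  shows "K = UNIV"
proof (rule UNIV_if_tangent_algebra_full [OF conn])
  have "tangent_algebra \<subseteq> lie_algebra gmul charts" by (auto simp: tangent_algebra_def)
  then have "lie_subalgebra gmul charts tangent_algebra"
    unfolding lie_subalgebra_def
    using subspace_tangent_algebra bracket_in_tangent_algebra lie_bracket_in_lie_algebra [OF gen] by blast
  then show "lie_algebra gmul charts \<subseteq> tangent_algebra"
    using V unfolding gen [symmetric] lie_algebra_generated_def by blast
qed

end

section \<open>The generated semigroup\<close>

lemma sqrt_2_irrational: "sqrt 2 \<notin> \<rat>"
proof
  assume "sqrt 2 \<in> \<rat>"
  then obtain m n :: nat where mn: "n \<noteq> 0" "\<bar>sqrt 2\<bar> = real m / real n" "coprime m n"
    by (rule Rats_abs_nat_div_natE)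
  then have "real m = sqrt 2 * real n" by (simp add: field_simps)
  then have "(real m)\<^sup>2 = 2 * (real n)\<^sup>2" by (simp add: power_mult_distrib)
  then have eq: "m\<^sup>2 = 2 * n\<^sup>2" by (metis of_nat_eq_iff of_nat_mult of_nat_numeral of_nat_power)
  then have "even (m\<^sup>2)" by simp
  then have "even m" by simp
  then obtain j where "m = 2 * j" by blast
  with eq have "2 * j\<^sup>2 = n\<^sup>2" by (simp add: power_mult_distrib)
  then have "even (n\<^sup>2)" by (metis dvd_triv_left)
  then have "even n" by simp
  with \<open>even m\<close> mn(3) show False using coprime_common_divisor [of m n 2] by auto
qed

text \<open>Density of fractional parts, aimed at \<open>\<sigma> * \<epsilon> / 2\<close> with
  tolerance \<open>\<epsilon> / 2\<close>, yields a small value of sign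
  \<open>\<sigma>\<close>.\<close>

lemma small_combination_sqrt_2:
  fixes \<epsilon> :: real
  assumes "0 < \<epsilon>" "\<epsilon> < 1" "\<sigma> = 1 \<or> \<sigma> = -1"
  obtains k h :: nat where "0 < \<sigma> * (real k * sqrt 2 - real h)" "\<sigma> * (real k * sqrt 2 - real h) < \<epsilon>"
proof -
  obtain h k :: int where hk: "k > 0" "\<bar>of_int k * sqrt 2 - of_int h - \<sigma> * \<epsilon> / 2\<bar> < \<epsilon> / 2"
    by (rule sequence_of_fractional_parts_is_dense [OF sqrt_2_irrational, of "\<epsilon> / 2" "\<sigma> * \<epsilon> / 2"])
       (use assms(1) in auto)
  have "1 * sqrt 2 \<le> of_int k * sqrt 2" using hk(1) by (intro mult_right_mono) auto
  moreover have "1 < sqrt 2" by simp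
  \<comment> \<open>Together with \<open>\<epsilon> < 1\<close> this forces \<open>h > 0\<close>, so
    both integers are natural numbers.\<close>
  ultimately have k: "of_int k * sqrt 2 > 1" by linarith
  have "0 < (of_int h :: real) \<and> 0 < \<sigma> * (of_int k * sqrt 2 - of_int h) \<and> \<sigma> * (of_int k * sqrt 2 - of_int h) < \<epsilon>"
    using assms(3)
  proof
    assume "\<sigma> = 1"
    with hk(2) have "\<bar>of_int k * sqrt 2 - of_int h - \<epsilon> / 2\<bar> < \<epsilon> / 2" by simp
    then have "0 < real_of_int h \<and> 0 < of_int k * sqrt 2 - of_int h \<and> of_int k * sqrt 2 - of_int h < \<epsilon>"
      using k assms(1,2) unfolding abs_less_iff by (intro conjI; linarith)
    then show ?thesis by (simp add: \<open>\<sigma> = 1\<close>)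
  next
    assume "\<sigma> = -1"
    with hk(2) have "\<bar>of_int k * sqrt 2 - of_int h + \<epsilon> / 2\<bar> < \<epsilon> / 2" by simp
    then have "0 < real_of_int h \<and> 0 < of_int h - of_int k * sqrt 2 \<and> of_int h - of_int k * sqrt 2 < \<epsilon>"
      using k assms(1,2) unfolding abs_less_iff by (intro conjI; linarith)
    then show ?thesis by (simp add: \<open>\<sigma> = -1\<close>)
  qed
  then show thesis using that [of "nat k" "nat h"] hk(1) by simp
qed

text \<open>A small combination with the sign of \<open>t\<close> is repeated until it is within one
  step of \<open>t\<close>; natural multiples keep both coefficients natural.\<close>

lemma nat_combinations_sqrt_2_dense:
  fixes t \<epsilon> :: real
  assumes "\<epsilon> > 0"
  obtains m n :: nat where "\<bar>real m * sqrt 2 - real n - t\<bar> < \<epsilon>"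
proof -
  define \<sigma> :: real where "\<sigma> = (if t \<ge> 0 then 1 else -1)"
  have \<sigma>: "\<sigma> = 1 \<or> \<sigma> = -1" "\<sigma> * t \<ge> 0" "\<sigma> * \<sigma> = 1" by (auto simp: \<sigma>_def)
  \<comment> \<open>The cap 1/2 meets the requirement of a bound below 1 in
    \<open>small_combination_sqrt_2\<close>.\<close>
  obtain k h :: nat where kh: "0 < \<sigma> * (real k * sqrt 2 - real h)" "\<sigma> * (real k * sqrt 2 - real h) < min \<epsilon> (1 / 2)"
    by (rule small_combination_sqrt_2 [OF _ _ \<sigma>(1), of "min \<epsilon> (1 / 2)"]) (use assms in auto)
  define \<delta> where "\<delta> = \<sigma> * (real k * sqrt 2 - real h)"
  define j where "j = nat \<lfloor>\<sigma> * t / \<delta>\<rfloor>"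
  have \<delta>: "0 < \<delta>" "\<delta> < \<epsilon>" using kh by (simp_all add: \<delta>_def)
  have "real j \<le> \<sigma> * t / \<delta>" "\<sigma> * t / \<delta> < real j + 1"
    unfolding j_def using \<sigma>(2) \<delta>(1) by simp_all
  then have "real j * \<delta> \<le> \<sigma> * t" "\<sigma> * t < (real j + 1) * \<delta>"
    using \<delta>(1) by (simp_all add: field_simps)
  then have "\<bar>real j * \<delta> - \<sigma> * t\<bar> < \<epsilon>" using \<delta> by (simp add: abs_less_iff algebra_simps)
  moreover have "real j * \<delta> - \<sigma> * t = \<sigma> * (real (j * k) * sqrt 2 - real (j * h) - t)"
    by (simp add: \<delta>_def algebra_simps)
  moreover have "\<bar>\<sigma> * u\<bar> = \<bar>u\<bar>" for u using \<sigma>(1) by (auto simp: abs_mult)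
  ultimately show thesis using that [of "j * k" "j * h"] by metis
qed

section \<open>Generated semigroups and their closures\<close>

context lie_group
begin

lemma foldr_gmul_append: "foldr gmul (zs @ ws) e = gmul (foldr gmul zs e) (foldr gmul ws e)"
  by (induction zs) (simp_all add: assoc group_left_neutral)

lemma semigroup_generated_gmul:
  assumes "g \<in> semigroup_generated gmul e X" "h \<in> semigroup_generated gmul e X"
  shows "gmul g h \<in> semigroup_generated gmul e X"
proof -
  obtain zs ws where "zs \<noteq> []" "set zs \<subseteq> X" "g = foldr gmul zs e" "ws \<noteq> []" "set ws \<subseteq> X" "h = foldr gmul ws e"
    using assms unfolding semigroup_generated_def by blast
  then have "gmul g h = foldr gmul (zs @ ws) e" "zs @ ws \<noteq> []" "set (zs @ ws) \<subseteq> X"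
    by (simp_all only: foldr_gmul_append) simp_all
  then show ?thesis unfolding semigroup_generated_def by blast
qed

lemma semigroup_generated_base: "g \<in> X \<Longrightarrow> g \<in> semigroup_generated gmul e X"
  unfolding semigroup_generated_def by (auto intro!: exI [of _ "[g]"])

lemma closure_gmul:
  assumes H: "\<And>g h. g \<in> H \<Longrightarrow> h \<in> H \<Longrightarrow> gmul g h \<in> H" and "g \<in> closure H" "h \<in> closure H"
  shows "gmul g h \<in> closure H"
proof -
  have "(\<lambda>(x, y). gmul x y) ` closure (H \<times> H) \<subseteq> closure H"
  proof (rule image_closure_subset)
    show "continuous_on (closure (H \<times> H)) (\<lambda>(x, y). gmul x y)"
      by (rule continuous_on_subset [OF continuous_gmul]) simp
    show "(\<lambda>(x, y). gmul x y) ` (H \<times> H) \<subseteq> closure H" using H closure_subset by fastforce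
  qed simp
  then show ?thesis using assms(2,3) by (auto simp: closure_Times)
qed

end

theorem theorem4p2:
  fixes gmul :: "'g::{t2_space, second_countable_topology} \<Rightarrow> 'g \<Rightarrow> 'g"
    and e :: 'g
    and ginv :: "'g \<Rightarrow> 'g"
    and charts :: "('g, 'e::real_normed_vector) chart set"
    and V A :: "('g, 'e) field set"
    and k :: nat
    and v :: "nat \<Rightarrow> ('g, 'e) field"
    and x y :: "nat \<Rightarrow> 'g"
    and X :: "'g set"
  assumes "lie_group gmul e ginv charts"
    and "connected (UNIV :: 'g set)"
    and "V \<subseteq> lie_algebra gmul charts" and "subspace V"
    and "lie_algebra_generated gmul charts V = lie_algebra gmul charts"
    and "inj_on v {1..k}" and "independent (v ` {1..k})" and "span (v ` {1..k}) = V"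
    and "0 \<in> A" and "exp_diffeo_on gmul e charts A"
    and "{(\<Sum>i=1..k. a i *\<^sub>R v i) | a :: nat \<Rightarrow> real. \<forall>i\<in>{1..k}. a i \<in> {-2..2}} \<subseteq> A"
    and "\<And>i. i \<in> {1..k} \<Longrightarrow> x i = lie_exp e charts (- v i)"
    and "\<And>i. i \<in> {1..k} \<Longrightarrow> y i = lie_exp e charts (sqrt 2 *\<^sub>R v i)"
    and "X = {e} \<union> x ` {1..k} \<union> y ` {1..k}"
  shows "closure (semigroup_generated gmul e X) = UNIV"
proof -
  obtain L :: "'e \<Rightarrow> ('g, 'e) field" where "linear L" "bij_betw L UNIV (lie_algebra gmul charts)"
    "diffeo_onto_image (L -` A) model_atlas charts (lie_exp e charts \<circ> L)"
    using assms(10) unfolding exp_diffeo_on_def by blast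
  then interpret lie_group_exp gmul e ginv charts A L
    using assms(1,9) by (simp add: lie_group_exp_def lie_group_exp_axioms_def)
  define P where "P = semigroup_generated gmul e X"
  have P: "g \<in> P \<Longrightarrow> h \<in> P \<Longrightarrow> gmul g h \<in> P" for g h unfolding P_def by (rule semigroup_generated_gmul)
  have XP: "X \<subseteq> P" unfolding P_def using semigroup_generated_base by blast
  \<comment> \<open>\<open>flow_multiple_in\<close> includes the zeroth power, which is in
    \<open>P\<close> since \<open>e \<in> X\<close>.\<close>
  have eP: "e \<in> P" using XP assms(14) by auto
  have vi: "v i \<in> lie_algebra gmul charts" if "i \<in> {1..k}" for i
    using that assms(3,8) span_base by blast
  have flow_v: "flow (v i) t \<in> closure P" if i: "i \<in> {1..k}" for i t
  proof -
    \<comment> \<open>\<open>x i\<close> and \<open>y i\<close> are the points at times -1 and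
      \<open>sqrt 2\<close> of one and the same one-parameter subgroup.\<close>
    have "flow (v i) (- 1) = x i" "flow (v i) (sqrt 2) = y i"
      using flow_scaleR [OF vi [OF i], of _ 1] assms(12,13) [OF i]
      by (simp_all add: lie_exp_flow) (metis scaleR_minus1_left)
    then have "flow (v i) (- 1) \<in> P" "flow (v i) (sqrt 2) \<in> P" using XP assms(14) i by auto
    then have "gmul (flow (v i) (real m * sqrt 2)) (flow (v i) (real n * - 1)) \<in> P" for m n
      by (intro P flow_multiple_in [OF vi [OF i] eP P])
    then have mn: "flow (v i) (real m * sqrt 2 - real n) \<in> P" for m n
      using flow_add [OF vi [OF i], of "real m * sqrt 2" "real n * - 1"] by simp
    \<comment> \<open>The times reached inside \<open>P\<close>. They are dense, and continuity of
      the flow carries \<open>closure N\<close> into \<open>closure P\<close>.\<close>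
    define N where "N = {real m * sqrt 2 - real n | m n. True}"
    have "t \<in> closure N"
      unfolding closure_approachable
    proof (intro allI impI)
      fix \<epsilon> :: real assume "\<epsilon> > 0"
      then obtain m n :: nat where "\<bar>real m * sqrt 2 - real n - t\<bar> < \<epsilon>"
        by (rule nat_combinations_sqrt_2_dense)
      then show "\<exists>u\<in>N. dist u t < \<epsilon>" unfolding N_def dist_real_def by blast
    qed
    moreover have "flow (v i) ` closure N \<subseteq> closure P"
    proof (rule image_closure_subset)
      show "continuous_on (closure N) (flow (v i))"
        by (rule continuous_on_subset [OF integral_curveD(2) [OF integral_curve_flow [OF vi [OF i]]]]) simp
      show "flow (v i) ` N \<subseteq> closure P" unfolding N_def using mn closure_subset by blast
    qed simp
    ultimately show ?thesis by blast
  qed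
  \<comment> \<open>\<open>closure P\<close> is so far a closed semigroup; its elements whose
    inverses also belong to it form a closed subgroup. The flows of the \<open>v i\<close> lie in
    \<open>K\<close> because \<open>flow_v\<close> covers times of both signs.\<close>
  define K where "K = {g. g \<in> closure P \<and> ginv g \<in> closure P}"
  have ginv_gmul: "ginv (gmul g h) = gmul (ginv h) (ginv g)" for g h
    by (rule inverse_distrib_swap)
  have cl: "g \<in> closure P \<Longrightarrow> h \<in> closure P \<Longrightarrow> gmul g h \<in> closure P" for g h
    by (rule closure_gmul [OF P])
  interpret closed_subgroup gmul e ginv charts A L K
  proof unfold_locales
    show "closed K" unfolding K_def Collect_conj_eq
      using continuous_closed_vimage [OF closed_closure [of P], of ginv] continuous_ginv
      by (intro closed_Int) (simp_all add: vimage_def continuous_on_eq_continuous_at)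
    show "e \<in> K" using eP closure_subset by (auto simp: K_def)
  qed (simp_all add: K_def ginv_gmul cl)
  have "v i \<in> tangent_algebra" if "i \<in> {1..k}" for i
  proof -
    have "flow (v i) t \<in> K" for t using flow_v [OF that] by (simp add: K_def ginv_flow vi [OF that])
    then show ?thesis using vi [OF that] by (simp add: tangent_algebra_def)
  qed
  then have "V \<subseteq> tangent_algebra"
    unfolding assms(8) [symmetric] using subspace_tangent_algebra by (intro span_minimal) auto
  then have "K = UNIV" by (rule UNIV_if_generating [OF assms(2,5)])
  then show ?thesis unfolding P_def [symmetric] K_def by blast
qed

end
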